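(* Let $U^n\in[H_0^1(\Omega)]^N$ satisfy $\langle U^n,U^n\rangle=I_N$ and let $\tau_n>0$. Then the numerical scheme $$\frac{U^{n+1}-U^n}{\tau_n}=-\mathcal{L}_{U^n}\frac{U^{n+1}+U^n}{2}$$ is well-posed, i.e. there is a unique $U^{n+1}\in[H_0^1(\Omega)]^N$ satisfying it. Moreover, $$\langle U^{n+1},U^{n+1}\rangle=\langle U^n,U^n\rangle=I_N .$$
   Context: Let $d,N\geqslant 1$ be integers and $\Omega\subset\mathbb{R}^d$ a bounded domain; all functions are real-valued. $(u,v)=\int_\Omega uv$ is the $L^2(\Omega)$ inner product and $\|\cdot\|$ its norm. $\mathcal{V}:\Omega\to\mathbb{R}$ is a potential such that $a(u,v)=\int_\Omega(\nabla u\cdot\nabla v+\mathcal{V}uv)$ is an inner product on $H_0^1(\Omega)$ and there are constants $c_1,c_2>0$ with $c_1\|\nabla u\|^2\leqslant a(u,u)\leqslant c_2\|\nabla u\|^2$ for all $u\in H_0^1(\Omega)$. The operator $\mathcal{G}=(-\Delta+\mathcal{V})^{-1}:H^{-1}(\Omega)\to H_0^1(\Omega)$ is defined by $a(\mathcal{G}f,v)=f(v)$ for all $v\in H_0^1(\Omega)$ (with $f(v)=(f,v)$ if $f\in L^2(\Omega)$), and acts componentwise on $N$-tuples. For $N$-tuples $U=(u_1,\dots,u_N)$, $V=(v_1,\dots,v_N)$, $\langle U,V\rangle\in\mathbb{R}^{N\times N}$ is the matrix with entries $(u_i,v_j)$. For $Q=(q_{ij})\in\mathbb{R}^{N\times N}$,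 $UQ$ is the $N$-tuple with $(UQ)_k=\sum_{i}u_iq_{ik}$. For $U\in[H_0^1(\Omega)]^N$, the operator $\mathcal{L}_U:[H_0^1(\Omega)]^N\to[H_0^1(\Omega)]^N$ is $\mathcal{L}_UV=U\langle\mathcal{G}U,V\rangle-\mathcal{G}U\langle U,V\rangle$. *)

theory Defs
  imports "HOL-Analysis.Analysis"
begin

text \<open>
  Elements of the function spaces over \<open>\<Omega>\<close> are represented by functions on the whole space, of
  which only the restriction to \<open>\<Omega>\<close> matters, and equality in these spaces is equality almost
  everywhere on \<open>\<Omega>\<close>.
\<close>

type_synonym 'd scalar_field = "real ^ 'd \<Rightarrow> real"

definition bounded_domain :: "(real ^ 'd::finite) set \<Rightarrow> bool" where
  "bounded_domain \<Omega> \<longleftrightarrow> open \<Omega> \<and> connected \<Omega> \<and> bounded \<Omega> \<and> \<Omega> \<noteq> {}"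

definition ae_eq :: "(real ^ 'd::finite) set \<Rightarrow> 'd scalar_field \<Rightarrow> 'd scalar_field \<Rightarrow> bool" where
  "ae_eq \<Omega> u v \<longleftrightarrow> (AE x in lebesgue_on \<Omega>. u x = v x)"


subsection \<open>Sobolev spaces\<close>

definition L2 :: "(real ^ 'd::finite) set \<Rightarrow> 'd scalar_field set" where
  "L2 \<Omega> = {u. u \<in> borel_measurable (lebesgue_on \<Omega>) \<and> integrable (lebesgue_on \<Omega>) (\<lambda>x. (u x)\<^sup>2)}"

definition L2_inner :: "(real ^ 'd::finite) set \<Rightarrow> 'd scalar_field \<Rightarrow> 'd scalar_field \<Rightarrow> real" where
  "L2_inner \<Omega> u v = (\<integral>x. u x * v x \<partial>lebesgue_on \<Omega>)"

definition partial_deriv :: "'d::finite \<Rightarrow> 'd scalar_field \<Rightarrow> 'd scalar_field" where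
  "partial_deriv i f x = frechet_derivative f (at x) (axis i 1)"

primrec Ck :: "nat \<Rightarrow> 'd::finite scalar_field \<Rightarrow> bool" where
  "Ck 0 f \<longleftrightarrow> continuous_on UNIV f"
| "Ck (Suc k) f \<longleftrightarrow> (\<forall>x. f differentiable (at x)) \<and> (\<forall>i. Ck k (partial_deriv i f))"

definition test_functions :: "(real ^ 'd::finite) set \<Rightarrow> 'd scalar_field set" where
  "test_functions \<Omega> =
     {\<phi>. (\<forall>k. Ck k \<phi>) \<and> compact (closure {x. \<phi> x \<noteq> 0}) \<and> closure {x. \<phi> x \<noteq> 0} \<subseteq> \<Omega>}"

definition weak_gradient ::
    "(real ^ 'd::finite) set \<Rightarrow> 'd scalar_field \<Rightarrow> (real ^ 'd \<Rightarrow> real ^ 'd) \<Rightarrow> bool" where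
  "weak_gradient \<Omega> u g \<longleftrightarrow>
     (\<forall>i. (\<lambda>x. g x $ i) \<in> L2 \<Omega>) \<and>
     (\<forall>\<phi> \<in> test_functions \<Omega>. \<forall>i.
        L2_inner \<Omega> u (partial_deriv i \<phi>) = - L2_inner \<Omega> (\<lambda>x. g x $ i) \<phi>)"

definition H1 :: "(real ^ 'd::finite) set \<Rightarrow> 'd scalar_field set" where
  "H1 \<Omega> = {u \<in> L2 \<Omega>. \<exists>g. weak_gradient \<Omega> u g}"

text \<open>A representative of the weak gradient, which is unique only almost everywhere.\<close>

definition grad :: "(real ^ 'd::finite) set \<Rightarrow> 'd scalar_field \<Rightarrow> real ^ 'd \<Rightarrow> real ^ 'd" where
  "grad \<Omega> u = (SOME g. weak_gradient \<Omega> u g)"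

definition grad_norm :: "(real ^ 'd::finite) set \<Rightarrow> 'd scalar_field \<Rightarrow> real" where
  "grad_norm \<Omega> u = sqrt (\<integral>x. (norm (grad \<Omega> u x))\<^sup>2 \<partial>lebesgue_on \<Omega>)"

definition H1_norm :: "(real ^ 'd::finite) set \<Rightarrow> 'd scalar_field \<Rightarrow> real" where
  "H1_norm \<Omega> u = sqrt (L2_inner \<Omega> u u + (grad_norm \<Omega> u)\<^sup>2)"

definition H10 :: "(real ^ 'd::finite) set \<Rightarrow> 'd scalar_field set" where
  "H10 \<Omega> = {u \<in> H1 \<Omega>. \<exists>\<phi>. (\<forall>n. \<phi> n \<in> test_functions \<Omega>) \<and>
                (\<lambda>n. H1_norm \<Omega> (\<lambda>x. \<phi> n x - u x)) \<longlonglongrightarrow> 0}"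


subsection \<open>The bilinear form and the operator \<open>\<G>\<close>\<close>

definition energy_form ::
    "(real ^ 'd::finite) set \<Rightarrow> 'd scalar_field \<Rightarrow> 'd scalar_field \<Rightarrow> 'd scalar_field \<Rightarrow> real" where
  "energy_form \<Omega> \<V> u v =
     (\<integral>x. (grad \<Omega> u x \<bullet> grad \<Omega> v x + \<V> x * u x * v x) \<partial>lebesgue_on \<Omega>)"

text \<open>
  The Bochner integral of a non-integrable function is \<open>0\<close>, so the existence of the integrals
  defining the form has to be required separately.
\<close>

definition energy_form_defined :: "(real ^ 'd::finite) set \<Rightarrow> 'd scalar_field \<Rightarrow> bool" where
  "energy_form_defined \<Omega> \<V> \<longleftrightarrow> (\<forall>u \<in> H10 \<Omega>. \<forall>v \<in> H10 \<Omega>.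
     integrable (lebesgue_on \<Omega>) (\<lambda>x. grad \<Omega> u x \<bullet> grad \<Omega> v x + \<V> x * u x * v x))"

definition inner_product_on_H10 ::
    "(real ^ 'd::finite) set \<Rightarrow> ('d scalar_field \<Rightarrow> 'd scalar_field \<Rightarrow> real) \<Rightarrow> bool" where
  "inner_product_on_H10 \<Omega> B \<longleftrightarrow>
     (\<forall>u \<in> H10 \<Omega>. \<forall>v \<in> H10 \<Omega>. B u v = B v u) \<and>
     (\<forall>u \<in> H10 \<Omega>. \<forall>v \<in> H10 \<Omega>. \<forall>w \<in> H10 \<Omega>. B (\<lambda>x. u x + v x) w = B u w + B v w) \<and>
     (\<forall>c. \<forall>u \<in> H10 \<Omega>. \<forall>v \<in> H10 \<Omega>. B (\<lambda>x. c * u x) v = c * B u v) \<and>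
     (\<forall>u \<in> H10 \<Omega>. 0 \<le> B u u) \<and>
     (\<forall>u \<in> H10 \<Omega>. B u u = 0 \<longleftrightarrow> ae_eq \<Omega> u (\<lambda>_. 0))"

text \<open>
  \<open>\<G>\<close> acts on functionals \<open>f\<close> on \<open>H10 \<Omega>\<close> and is meaningful for the bounded linear ones, the
  elements of the dual space \<open>H\<^sup>-\<^sup>1\<close>. Its value is a representative, unique only almost everywhere.
\<close>

definition solution_op ::
    "(real ^ 'd::finite) set \<Rightarrow> 'd scalar_field \<Rightarrow> ('d scalar_field \<Rightarrow> real) \<Rightarrow> 'd scalar_field" where
  "solution_op \<Omega> \<V> f = (SOME u. u \<in> H10 \<Omega> \<and> (\<forall>v \<in> H10 \<Omega>. energy_form \<Omega> \<V> u v = f v))"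


subsection \<open>Tuples of functions\<close>

type_synonym ('d, 'n) field_tuple = "'n \<Rightarrow> 'd scalar_field"

definition H10_tuples :: "(real ^ 'd::finite) set \<Rightarrow> ('d, 'n::finite) field_tuple set" where
  "H10_tuples \<Omega> = {U. \<forall>i. U i \<in> H10 \<Omega>}"

definition tuple_ae_eq ::
    "(real ^ 'd::finite) set \<Rightarrow> ('d, 'n::finite) field_tuple \<Rightarrow> ('d, 'n) field_tuple \<Rightarrow> bool" where
  "tuple_ae_eq \<Omega> U V \<longleftrightarrow> (\<forall>i. ae_eq \<Omega> (U i) (V i))"

definition gram ::
    "(real ^ 'd::finite) set \<Rightarrow> ('d, 'n::finite) field_tuple \<Rightarrow> ('d, 'n) field_tuple
      \<Rightarrow> real ^ 'n ^ 'n" where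
  "gram \<Omega> U V = (\<chi> i j. L2_inner \<Omega> (U i) (V j))"

definition tuple_mult ::
    "('d::finite, 'n::finite) field_tuple \<Rightarrow> real ^ 'n ^ 'n \<Rightarrow> ('d, 'n) field_tuple" where
  "tuple_mult U Q = (\<lambda>k x. \<Sum>i\<in>UNIV. U i x * Q $ i $ k)"

definition tuple_solution_op ::
    "(real ^ 'd::finite) set \<Rightarrow> 'd scalar_field \<Rightarrow> ('d, 'n::finite) field_tuple
      \<Rightarrow> ('d, 'n) field_tuple" where
  "tuple_solution_op \<Omega> \<V> U = (\<lambda>i. solution_op \<Omega> \<V> (L2_inner \<Omega> (U i)))"

definition L_op ::
    "(real ^ 'd::finite) set \<Rightarrow> 'd scalar_field \<Rightarrow> ('d, 'n::finite) field_tuple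
      \<Rightarrow> ('d, 'n) field_tuple \<Rightarrow> ('d, 'n) field_tuple" where
  "L_op \<Omega> \<V> U V = (\<lambda>k x.
     tuple_mult U (gram \<Omega> (tuple_solution_op \<Omega> \<V> U) V) k x
     - tuple_mult (tuple_solution_op \<Omega> \<V> U) (gram \<Omega> U V) k x)"

definition scheme_step ::
    "(real ^ 'd::finite) set \<Rightarrow> 'd scalar_field \<Rightarrow> real \<Rightarrow> ('d, 'n::finite) field_tuple
      \<Rightarrow> ('d, 'n) field_tuple \<Rightarrow> bool" where
  "scheme_step \<Omega> \<V> \<tau> U U' \<longleftrightarrow>
     tuple_ae_eq \<Omega>
       (\<lambda>k x. (U' k x - U k x) / \<tau>)
       (\<lambda>k x. - L_op \<Omega> \<V> U (\<lambda>j y. (U' j y + U j y) / 2) k x)"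

end

theory Submission
  imports Defs
begin

text \<open>
  For fixed \<open>U\<close> the operator \<open>\<L>\<^sub>U\<close> is skew-symmetric for the \<open>L\<^sup>2\<close> inner product and acts on each
  component separately, with values in the span of the \<open>U i\<close> and \<open>\<G>U i\<close>. In terms of the midpoint
  \<open>V = (U' + U) / 2\<close> the scheme reads \<open>V + \<tau>/2 * \<L>\<^sub>U V = U\<close>: skew-symmetry makes the homogeneous
  equation only trivially solvable, hence the problem, which is finite-dimensional, uniquely solvable.
  Skew-symmetry also gives \<open>\<langle>U', U'\<rangle> - \<langle>U, U\<rangle> = \<langle>V, U' - U\<rangle> + \<langle>U' - U, V\<rangle> = 0\<close>.
  What remains is that \<open>\<G>U\<close> lies in \<open>H10 \<Omega>\<close>, that is, the Riesz representation theorem. It rests on the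
  Poincare inequality and the completeness of \<open>H10 \<Omega>\<close>, and for the latter on the uniqueness of weak
  gradients, which makes \<open>grad\<close> linear almost everywhere.
\<close>

subsection \<open>Square integrable functions\<close>

text \<open>Skew-symmetry comes from the shape \<open>a * (b, v) - b * (a, v)\<close> and holds for
  any square integrable \<open>a\<close> and \<open>b\<close>. The analysis is there because
  \<open>solution_op\<close> is a choice among solutions: its value is known to lie in
  \<open>H10 \<Omega>\<close> only once a solution is known to exist. The obstacle throughout is
  that fields are functions, not classes. \<open>grad\<close> is likewise a choice, so that the
  gradient of a sum need not be pointwise the sum of the gradients. Norms of gradients are therefore
  computed, squared and component by component, from whichever weak gradient is at hand. The
  uniqueness behind this needs a rich supply of test functions, built from exp (-1/t). The Poincare
  inequality enters twice: it bounds the functional v -> (w, v) by the energy, and it upgrades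
  convergence of gradients to convergence in \<open>L2\<close>. The size of the time step does not
  matter, since a skew operator has no nonzero real eigenvalue.\<close>

lemma L2_measurable: "u \<in> L2 \<Omega> \<Longrightarrow> u \<in> borel_measurable (lebesgue_on \<Omega>)"
  by (simp add: L2_def)

lemma integrable_mult_L2:
  assumes "u \<in> L2 \<Omega>" "v \<in> L2 \<Omega>"
  shows "integrable (lebesgue_on \<Omega>) (\<lambda>x. u x * v x)"
proof (rule Bochner_Integration.integrable_bound)
  show "integrable (lebesgue_on \<Omega>) (\<lambda>x. (u x)\<^sup>2 + (v x)\<^sup>2)"
    using assms by (auto simp: L2_def)
  show "(\<lambda>x. u x * v x) \<in> borel_measurable (lebesgue_on \<Omega>)"
    using assms by (auto simp: L2_def)
  have "\<bar>a * b\<bar> \<le> a\<^sup>2 + b\<^sup>2" for a b :: real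
    using sum_squares_bound[of "\<bar>a\<bar>" "\<bar>b\<bar>"] abs_ge_zero[of "a * b"] unfolding abs_mult power2_abs
    by linarith
  then show "AE x in lebesgue_on \<Omega>. norm (u x * v x) \<le> norm ((u x)\<^sup>2 + (v x)\<^sup>2)"
    by auto
qed

lemma L2_add: "u \<in> L2 \<Omega> \<Longrightarrow> v \<in> L2 \<Omega> \<Longrightarrow> (\<lambda>x. u x + v x) \<in> L2 \<Omega>"
  using integrable_mult_L2[of u \<Omega> v] by (auto simp: L2_def power2_sum mult.assoc)

lemma L2_cmult: "u \<in> L2 \<Omega> \<Longrightarrow> (\<lambda>x. c * u x) \<in> L2 \<Omega>"
  by (auto simp: L2_def power_mult_distrib)

lemma L2_zero [simp]: "(\<lambda>x. 0) \<in> L2 \<Omega>"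
  by (simp add: L2_def)

lemma L2_diff: "u \<in> L2 \<Omega> \<Longrightarrow> v \<in> L2 \<Omega> \<Longrightarrow> (\<lambda>x. u x - v x) \<in> L2 \<Omega>"
  using L2_add[of u \<Omega> "\<lambda>x. (-1) * v x"] L2_cmult[of v \<Omega> "-1"] by simp

section \<open>The \<open>L2\<close> inner product\<close>

lemma L2_inner_commute: "L2_inner \<Omega> u v = L2_inner \<Omega> v u"
  by (simp add: L2_inner_def mult.commute)

lemma L2_inner_add_left:
  assumes "u \<in> L2 \<Omega>" "v \<in> L2 \<Omega>" "w \<in> L2 \<Omega>"
  shows "L2_inner \<Omega> (\<lambda>x. u x + v x) w = L2_inner \<Omega> u w + L2_inner \<Omega> v w"
  using assms by (simp add: L2_inner_def distrib_right integrable_mult_L2)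

lemma L2_inner_diff_left:
  assumes "u \<in> L2 \<Omega>" "v \<in> L2 \<Omega>" "w \<in> L2 \<Omega>"
  shows "L2_inner \<Omega> (\<lambda>x. u x - v x) w = L2_inner \<Omega> u w - L2_inner \<Omega> v w"
  using assms by (simp add: L2_inner_def left_diff_distrib integrable_mult_L2)

lemma L2_inner_cmult_left: "L2_inner \<Omega> (\<lambda>x. c * u x) v = c * L2_inner \<Omega> u v"
  by (simp add: L2_inner_def mult.assoc)

lemma L2_inner_add_right:
  assumes "u \<in> L2 \<Omega>" "v \<in> L2 \<Omega>" "w \<in> L2 \<Omega>"
  shows "L2_inner \<Omega> w (\<lambda>x. u x + v x) = L2_inner \<Omega> w u + L2_inner \<Omega> w v"
  using L2_inner_add_left[OF assms] by (simp add: L2_inner_commute)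

lemma L2_inner_cmult_right: "L2_inner \<Omega> u (\<lambda>x. c * v x) = c * L2_inner \<Omega> u v"
  by (simp add: L2_inner_def mult.left_commute)

lemma L2_inner_self_nonneg: "0 \<le> L2_inner \<Omega> u u"
  by (simp add: L2_inner_def)

lemma L2_inner_self_eq_0_imp:
  assumes "u \<in> L2 \<Omega>" "L2_inner \<Omega> u u = 0"
  shows "ae_eq \<Omega> u (\<lambda>_. 0)"
  using assms integral_nonneg_eq_0_iff_AE[OF integrable_mult_L2[OF assms(1,1)]]
  by (auto simp: L2_inner_def ae_eq_def)

lemma L2_inner_ae_cong:
  assumes "u \<in> L2 \<Omega>" "v \<in> L2 \<Omega>" "u' \<in> L2 \<Omega>" "v' \<in> L2 \<Omega>" "ae_eq \<Omega> u u'" "ae_eq \<Omega> v v'"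
  shows "L2_inner \<Omega> u v = L2_inner \<Omega> u' v'"
  unfolding L2_inner_def
  using assms by (intro integral_cong_AE) (auto simp: L2_def ae_eq_def)

text \<open>At its minimum \<open>t = - b / c\<close> the quadratic equals
  \<open>a - b\<^sup>2 / c\<close>; for \<open>c = 0\<close> an affine function bounded below is
  constant. Every estimate of Cauchy-Schwarz type below is an instance, including the one for
  near-minimisers in the Riesz theorem.\<close>

lemma discriminant_nonpos:
  fixes a b c :: real
  assumes "\<And>t. 0 \<le> a + 2 * t * b + t\<^sup>2 * c" "0 \<le> c"
  shows "b\<^sup>2 \<le> a * c"
proof (cases "c = 0")
  case True
  have "b = 0"
  proof (rule ccontr)
    assume "b \<noteq> 0"
    \<comment> \<open>The point is chosen so that the affine function takes the value -1
      there.\<close>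
    then have "a + 2 * (- (a + 1) / (2 * b)) * b + (- (a + 1) / (2 * b))\<^sup>2 * c = -1"
      using True by (simp add: field_simps)
    then show False using assms(1)[of "- (a + 1) / (2 * b)"] by linarith
  qed
  then show ?thesis using True by simp
next
  case False
  then have "a + 2 * (- b / c) * b + (- b / c)\<^sup>2 * c = a - b\<^sup>2 / c"
    by (simp add: field_simps power2_eq_square)
  then have "b\<^sup>2 / c \<le> a" using assms(1)[of "- b / c"] by linarith
  then show ?thesis using False assms(2) by (simp add: field_simps)
qed

lemma L2_inner_add_cmult_self:
  assumes "u \<in> L2 \<Omega>" "v \<in> L2 \<Omega>"
  shows "L2_inner \<Omega> (\<lambda>x. u x + t * v x) (\<lambda>x. u x + t * v x)
    = L2_inner \<Omega> u u + 2 * t * L2_inner \<Omega> u v + t\<^sup>2 * L2_inner \<Omega> v v"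
  using assms
  by (simp add: L2_inner_add_left L2_inner_add_right L2_add L2_cmult L2_inner_cmult_left
      L2_inner_cmult_right L2_inner_commute[of \<Omega> v u] power2_eq_square algebra_simps)

lemma L2_Cauchy_Schwarz:
  assumes "u \<in> L2 \<Omega>" "v \<in> L2 \<Omega>"
  shows "(L2_inner \<Omega> u v)\<^sup>2 \<le> L2_inner \<Omega> u u * L2_inner \<Omega> v v"
  by (rule discriminant_nonpos)
    (use L2_inner_self_nonneg[of \<Omega>] L2_inner_add_cmult_self[OF assms] in metis)+

text \<open>The parallelogram identity, with the square of the difference dropped. It stands in for
  the triangle inequality and keeps square roots out of the estimates, at the price of factors
  2.\<close>

lemma L2_inner_add_self_le:
  assumes "u \<in> L2 \<Omega>" "v \<in> L2 \<Omega>"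
  shows "L2_inner \<Omega> (\<lambda>x. u x + v x) (\<lambda>x. u x + v x) \<le> 2 * L2_inner \<Omega> u u + 2 * L2_inner \<Omega> v v"
  using L2_inner_add_cmult_self[OF assms, of 1] L2_inner_add_cmult_self[OF assms, of "-1"]
    L2_inner_self_nonneg[of \<Omega> "\<lambda>x. u x + -1 * v x"] by simp

section \<open>Convergence and completeness in \<open>L2\<close>\<close>

lemma L2_inner_tendsto:
  assumes "\<And>n. u n \<in> L2 \<Omega>" "u' \<in> L2 \<Omega>" "v \<in> L2 \<Omega>"
    and lim: "(\<lambda>n. L2_inner \<Omega> (\<lambda>x. u n x - u' x) (\<lambda>x. u n x - u' x)) \<longlonglongrightarrow> 0"
  shows "(\<lambda>n. L2_inner \<Omega> (u n) v) \<longlonglongrightarrow> L2_inner \<Omega> u' v"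
proof -
  have "(\<lambda>n. (L2_inner \<Omega> (\<lambda>x. u n x - u' x) v)\<^sup>2) \<longlonglongrightarrow> 0"
  proof (rule tendsto_sandwich[OF _ _ tendsto_const])
    show "(\<lambda>n. L2_inner \<Omega> (\<lambda>x. u n x - u' x) (\<lambda>x. u n x - u' x) * L2_inner \<Omega> v v) \<longlonglongrightarrow> 0"
      using tendsto_mult_right[OF lim, of "L2_inner \<Omega> v v"] by simp
  qed (use assms in \<open>auto intro!: always_eventually L2_Cauchy_Schwarz L2_diff\<close>)
  then have "(\<lambda>n. L2_inner \<Omega> (\<lambda>x. u n x - u' x) v) \<longlonglongrightarrow> 0" by simp
  then show ?thesis
    using assms by (simp add: L2_inner_diff_left Lim_null[symmetric])
qed

text \<open>The weights \<open>2 ^ k\<close> still leave integrals bounded by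
  \<open>(1/2) ^ k\<close>, so the weighted series is finite almost everywhere. Its terms then tend
  to 0, which forces \<open>\<bar>w k x\<bar> \<le> sqrt (1/2) ^ k\<close> for large
  \<open>k\<close>: a geometric majorant for \<open>w\<close> itself and not only for its
  square.\<close>

lemma AE_summable_of_weighted_squares:
  fixes w :: "nat \<Rightarrow> 'a \<Rightarrow> real"
  assumes [measurable]: "\<And>k. w k \<in> borel_measurable M"
    and int: "\<And>k. integrable M (\<lambda>x. (w k x)\<^sup>2)"
    and le: "\<And>k. (\<integral>x. (w k x)\<^sup>2 \<partial>M) \<le> (1/4) ^ k"
  shows "AE x in M. summable (\<lambda>k. w k x)"
proof -
  have "(\<integral>\<^sup>+x. (\<Sum>k. ennreal (2 ^ k * (w k x)\<^sup>2)) \<partial>M) = (\<Sum>k. \<integral>\<^sup>+x. ennreal (2 ^ k * (w k x)\<^sup>2) \<partial>M)"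
    by (intro nn_integral_suminf) auto
  also have "\<dots> = (\<Sum>k. ennreal (2 ^ k * (\<integral>x. (w k x)\<^sup>2 \<partial>M)))"
    using int by (subst nn_integral_eq_integral) auto
  also have "\<dots> \<le> (\<Sum>k. ennreal ((1/2) ^ k))"
  proof (intro suminf_le ennreal_leI)
    fix k
    have "2 ^ k * (\<integral>x. (w k x)\<^sup>2 \<partial>M) \<le> 2 ^ k * (1/4) ^ k"
      using le by (intro mult_left_mono) auto
    also have "\<dots> = (1/2) ^ k" by (simp flip: power_mult_distrib)
    finally show "2 ^ k * (\<integral>x. (w k x)\<^sup>2 \<partial>M) \<le> (1/2) ^ k" .
  qed auto
  also have "\<dots> = ennreal (\<Sum>k. (1/2) ^ k)"
    by (rule suminf_ennreal_eq) (auto intro!: summable_sums summable_geometric)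
  also have "\<dots> < \<infinity>" by simp
  finally have "(\<integral>\<^sup>+x. (\<Sum>k. ennreal (2 ^ k * (w k x)\<^sup>2)) \<partial>M) \<noteq> \<infinity>" by simp
  then have "AE x in M. (\<Sum>k. ennreal (2 ^ k * (w k x)\<^sup>2)) \<noteq> \<infinity>"
    by (intro nn_integral_noteq_infinite) auto
  then show ?thesis
  proof eventually_elim
    fix x assume "(\<Sum>k. ennreal (2 ^ k * (w k x)\<^sup>2)) \<noteq> \<infinity>"
    then have "summable (\<lambda>k. 2 ^ k * (w k x)\<^sup>2)"
      by (intro summable_suminf_not_top) auto
    then have "(\<lambda>k. 2 ^ k * (w k x)\<^sup>2) \<longlonglongrightarrow> 0" by (rule summable_LIMSEQ_zero)
    then have "eventually (\<lambda>k. 2 ^ k * (w k x)\<^sup>2 < 1) sequentially"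
      by (rule order_tendstoD) simp
    then have "eventually (\<lambda>k. norm (w k x) \<le> (sqrt (1/2)) ^ k) sequentially"
    proof eventually_elim
      case (elim k)
      then have "(w k x)\<^sup>2 \<le> (1/2) ^ k" by (simp add: field_simps power_divide)
      then have "sqrt ((w k x)\<^sup>2) \<le> sqrt ((1/2) ^ k)" by (rule real_sqrt_le_mono)
      then show ?case unfolding real_sqrt_abs by (simp add: real_sqrt_power)
    qed
    then show "summable (\<lambda>k. w k x)"
    proof (rule summable_comparison_test_ev)
      show "summable (\<lambda>k. (sqrt (1/2)) ^ k :: real)"
        by (intro summable_geometric) (simp add: real_sqrt_divide)
    qed
  qed
qed

text \<open>The Riesz-Fischer argument: a rapidly converging subsequence has a pointwise limit
  almost everywhere, and Fatou's lemma along that subsequence bounds the distance of every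
  \<open>u n\<close> to the limit by the Cauchy bound, so that the whole sequence converges.\<close>

theorem L2_complete:
  assumes u: "\<And>n. u n \<in> L2 \<Omega>"
    and Cauchy: "\<And>e. e > 0 \<Longrightarrow>
      \<exists>N. \<forall>m\<ge>N. \<forall>n\<ge>N. L2_inner \<Omega> (\<lambda>x. u m x - u n x) (\<lambda>x. u m x - u n x) \<le> e"
  obtains u' where "u' \<in> L2 \<Omega>"
    and "(\<lambda>n. L2_inner \<Omega> (\<lambda>x. u n x - u' x) (\<lambda>x. u n x - u' x)) \<longlonglongrightarrow> 0"
proof -
  define M where "M = lebesgue_on \<Omega>"
  define D where "D m n = L2_inner \<Omega> (\<lambda>x. u m x - u n x) (\<lambda>x. u m x - u n x)" for m n
  have [measurable]: "u n \<in> borel_measurable M" for n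
    using u by (simp add: L2_def M_def)
  have D_int: "integrable M (\<lambda>x. (u m x - u n x)\<^sup>2)" for m n
    using L2_diff[OF u u] by (auto simp: L2_def M_def)
  have D_eq: "D m n = (\<integral>x. (u m x - u n x)\<^sup>2 \<partial>M)" for m n
    by (simp add: D_def L2_inner_def M_def power2_eq_square)
  obtain N where N: "D m n \<le> (1/4) ^ k" if "N k \<le> m" "N k \<le> n" for k m n
    proof -
    have "\<forall>k. \<exists>N. \<forall>m\<ge>N. \<forall>n\<ge>N. D m n \<le> (1/4) ^ k"
      unfolding D_def by (intro allI Cauchy) simp
    then show thesis using that by metis
  qed
  \<comment> \<open>The sum makes \<open>r\<close> monotone and at least \<open>N k\<close>; the
    summand \<open>k\<close> makes it unbounded.\<close>
  define r where "r k = (\<Sum>j\<le>k. N j) + k" for k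
  have r_ge: "N k \<le> r k" for k
    by (simp add: r_def trans_le_add1 member_le_sum)
  have r_mono: "r k \<le> r (Suc k)" for k by (simp add: r_def)
  have r_ge_id: "k \<le> r k" for k by (simp add: r_def)
  have "AE x in M. summable (\<lambda>k. u (r (Suc k)) x - u (r k) x)"
  proof (rule AE_summable_of_weighted_squares)
    show "(\<integral>x. (u (r (Suc k)) x - u (r k) x)\<^sup>2 \<partial>M) \<le> (1/4) ^ k" for k
      using N[of k "r (Suc k)" "r k"] r_ge[of k] r_mono[of k] by (simp add: D_eq)
  qed (auto intro: D_int)
  then have AE_conv: "AE x in M. convergent (\<lambda>k. u (r k) x)"
  proof eventually_elim
    fix x assume "summable (\<lambda>k. u (r (Suc k)) x - u (r k) x)"
    then have "convergent (\<lambda>n. \<Sum>k<n. u (r (Suc k)) x - u (r k) x)"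
      by (simp add: summable_iff_convergent)
    then have "convergent (\<lambda>n. u (r n) x - u (r 0) x)"
      by (simp add: sum_lessThan_telescope[of "\<lambda>k. u (r k) x"])
    then show "convergent (\<lambda>k. u (r k) x)"
      by (simp add: convergent_diff_const_right_iff)
  qed
  \<comment> \<open>\<open>lim\<close> is total and preserves measurability; its value where the
    subsequence diverges is arbitrary, but that set is null.\<close>
  define u' where "u' x = lim (\<lambda>k. u (r k) x)" for x
  have [measurable]: "u' \<in> borel_measurable M"
    unfolding u'_def by measurable
  have AE_lim: "AE x in M. (\<lambda>k. u (r k) x) \<longlonglongrightarrow> u' x"
    using AE_conv by eventually_elim (simp add: u'_def convergent_LIMSEQ_iff)
  have Fatou: "(\<integral>\<^sup>+x. ennreal ((u n x - u' x)\<^sup>2) \<partial>M) \<le> ennreal e"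
    if e: "e \<ge> 0" and n: "\<And>m. m \<ge> N0 \<Longrightarrow> D n m \<le> e" for n N0 e
  proof -
    have "(\<integral>\<^sup>+x. ennreal ((u n x - u' x)\<^sup>2) \<partial>M)
        = (\<integral>\<^sup>+x. liminf (\<lambda>k. ennreal ((u n x - u (r k) x)\<^sup>2)) \<partial>M)"
    proof (rule nn_integral_cong_AE)
      show "AE x in M. ennreal ((u n x - u' x)\<^sup>2) = liminf (\<lambda>k. ennreal ((u n x - u (r k) x)\<^sup>2))"
        using AE_lim
      proof eventually_elim
        case (elim x)
        then have "(\<lambda>k. ennreal ((u n x - u (r k) x)\<^sup>2)) \<longlonglongrightarrow> ennreal ((u n x - u' x)\<^sup>2)"
          by (intro tendsto_intros)
        then show ?case by (rule lim_imp_Liminf[OF sequentially_bot, symmetric])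
      qed
    qed
    also have "\<dots> \<le> liminf (\<lambda>k. \<integral>\<^sup>+x. ennreal ((u n x - u (r k) x)\<^sup>2) \<partial>M)"
      by (rule nn_integral_liminf) measurable
    also have "\<dots> = liminf (\<lambda>k. ennreal (D n (r k)))"
      by (simp add: nn_integral_eq_integral D_int D_eq)
    also have "\<dots> \<le> liminf (\<lambda>k. ennreal e)"
    proof (rule Liminf_mono)
      show "\<forall>\<^sub>F k in sequentially. ennreal (D n (r k)) \<le> ennreal e"
        using eventually_ge_at_top[of N0]
        by eventually_elim (use n r_ge_id in \<open>auto intro!: ennreal_leI intro: order_trans\<close>)
    qed
    finally show ?thesis by (simp add: Liminf_const)
  qed
  have diff_L2: "(\<lambda>x. u n x - u' x) \<in> L2 \<Omega> \<and> L2_inner \<Omega> (\<lambda>x. u n x - u' x) (\<lambda>x. u n x - u' x) \<le> e"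
    if e: "e \<ge> 0" and n: "\<And>m. m \<ge> N0 \<Longrightarrow> D n m \<le> e" for n N0 e
  proof -
    have *: "(\<integral>\<^sup>+x. ennreal ((u n x - u' x)\<^sup>2) \<partial>M) \<le> ennreal e" by (rule Fatou[OF that])
    then have int: "integrable M (\<lambda>x. (u n x - u' x)\<^sup>2)"
      by (intro integrableI_bounded) (auto intro: le_less_trans)
    have "(\<integral>x. (u n x - u' x)\<^sup>2 \<partial>M) \<le> e"
      using * e int by (simp add: nn_integral_eq_integral)
    then show ?thesis using int
      by (auto simp: L2_def L2_inner_def power2_eq_square simp flip: M_def)
  qed
  show thesis
  proof
    \<comment> \<open>The bound for index 0 is \<open>(1/4) ^ 0 = 1\<close>. Subtracting this
      difference from \<open>u (N 0)\<close> recovers \<open>u'\<close>.\<close>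
    have "(\<lambda>x. u (N 0) x - u' x) \<in> L2 \<Omega>"
      using diff_L2[of 1 "N 0" "N 0"] N[of 0 "N 0"] by auto
    from L2_diff[OF u[of "N 0"] this] show "u' \<in> L2 \<Omega>" by simp
    show "(\<lambda>n. L2_inner \<Omega> (\<lambda>x. u n x - u' x) (\<lambda>x. u n x - u' x)) \<longlonglongrightarrow> 0"
    proof (rule LIMSEQ_I)
      fix e :: real assume "e > 0"
      then obtain N0 where N0: "\<And>m n. m \<ge> N0 \<Longrightarrow> n \<ge> N0 \<Longrightarrow> D m n \<le> e / 2"
        using Cauchy[of "e/2"] by (auto simp: D_def)
      have "norm (L2_inner \<Omega> (\<lambda>x. u n x - u' x) (\<lambda>x. u n x - u' x) - 0) < e" if "n \<ge> N0" for n
        using diff_L2[of "e/2" N0 n] N0 that \<open>e > 0\<close> L2_inner_self_nonneg[of \<Omega> "\<lambda>x. u n x - u' x"]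
        by fastforce
      then show "\<exists>N0. \<forall>n\<ge>N0. norm (L2_inner \<Omega> (\<lambda>x. u n x - u' x) (\<lambda>x. u n x - u' x) - 0) < e"
        by blast
    qed
  qed
qed

subsection \<open>Smooth functions\<close>

lemma partial_deriv_eqI: "(f has_derivative f') (at x) \<Longrightarrow> partial_deriv i f x = f' (axis i 1)"
  by (simp add: partial_deriv_def frechet_derivative_at[symmetric])

lemma partial_deriv_add:
  assumes "f differentiable at x" "g differentiable at x"
  shows "partial_deriv i (\<lambda>x. f x + g x) x = partial_deriv i f x + partial_deriv i g x"
proof -
  note [derivative_intros] = assms[unfolded frechet_derivative_works]
  show ?thesis
    unfolding partial_deriv_def[of _ f] partial_deriv_def[of _ g]
    by (rule partial_deriv_eqI) (auto intro!: derivative_eq_intros)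
qed

lemma partial_deriv_cmult:
  assumes "f differentiable at x"
  shows "partial_deriv i (\<lambda>x. c * f x) x = c * partial_deriv i f x"
proof -
  note [derivative_intros] = assms[unfolded frechet_derivative_works]
  show ?thesis
    unfolding partial_deriv_def[of _ f]
    by (rule partial_deriv_eqI) (auto intro!: derivative_eq_intros)
qed

lemma partial_deriv_mult:
  assumes "f differentiable at x" "g differentiable at x"
  shows "partial_deriv i (\<lambda>x. f x * g x) x = f x * partial_deriv i g x + partial_deriv i f x * g x"
proof -
  note [derivative_intros] = assms[unfolded frechet_derivative_works]
  show ?thesis
    unfolding partial_deriv_def[of _ f] partial_deriv_def[of _ g]
    by (rule partial_deriv_eqI) (auto intro!: derivative_eq_intros)
qed

lemma partial_deriv_component: "partial_deriv i (\<lambda>x. x $ j) x = (if i = j then 1 else 0)"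
proof -
  have "((\<lambda>x. x $ j) has_derivative (\<lambda>h. h $ j)) (at x)"
    by (intro bounded_linear_imp_has_derivative bounded_linear_vec_nth)
  from partial_deriv_eqI[OF this] show ?thesis by (simp add: axis_def)
qed

lemma Ck_add: "Ck k f \<Longrightarrow> Ck k g \<Longrightarrow> Ck k (\<lambda>x. f x + g x)"
proof (induction k arbitrary: f g)
  case (Suc k)
  have "partial_deriv i (\<lambda>x. f x + g x) = (\<lambda>x. partial_deriv i f x + partial_deriv i g x)" for i
    using Suc.prems by (auto simp: partial_deriv_add)
  then show ?case using Suc by auto
qed (simp add: continuous_on_add)

lemma Ck_cmult: "Ck k f \<Longrightarrow> Ck k (\<lambda>x. c * f x)"
proof (induction k arbitrary: f)
  case (Suc k)
  have "partial_deriv i (\<lambda>x. c * f x) = (\<lambda>x. c * partial_deriv i f x)" for i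
    using Suc.prems by (auto simp: partial_deriv_cmult)
  then show ?case using Suc by auto
qed (simp add: continuous_on_mult_left)

text \<open>
  The derivative of \<open>exp_inv m\<close> is \<open>exp_inv (m + 2) - m * exp_inv (m + 1)\<close>, so that the family is
  closed under differentiation, also at \<open>0\<close>.
\<close>

definition exp_inv :: "nat \<Rightarrow> real \<Rightarrow> real" where
  "exp_inv m t = (if t > 0 then exp (- (1 / t)) / t ^ m else 0)"

lemma exp_inv_has_field_derivative:
  "(exp_inv m has_field_derivative (exp_inv (m + 2) t - real m * exp_inv (m + 1) t)) (at t)"
proof (cases t "0 :: real" rule: linorder_cases)
  case less
  have "\<forall>\<^sub>F x in nhds t. x < 0"
    using less eventually_nhds_in_open[of "{..<0}" t] by simp
  then have "\<forall>\<^sub>F x in nhds t. exp_inv m x = 0"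
    by eventually_elim (simp add: exp_inv_def)
  then have "(exp_inv m has_field_derivative 0) (at t)"
    by (subst DERIV_cong_ev[OF refl _ refl, of _ "\<lambda>_. 0"]) auto
  then show ?thesis using less by (simp add: exp_inv_def)
next
  case equal
  have "((\<lambda>h. exp_inv m h / h) \<longlongrightarrow> 0) (at 0)"
  proof (rule filterlim_split_at)
    have "\<forall>\<^sub>F h in at_left 0. exp_inv m h / h = (0::real)"
      by (auto simp: eventually_at_filter exp_inv_def)
    then show "((\<lambda>h. exp_inv m h / h) \<longlongrightarrow> 0) (at_left 0)"
      by (rule tendsto_eventually)
    \<comment> \<open>With \<open>x = inverse h\<close> the right-hand difference quotient at 0
      becomes \<open>x ^ Suc m / exp x\<close>; the additional power of \<open>x\<close> stems from
      the division by \<open>h\<close>.\<close>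
    have "((\<lambda>x. x ^ Suc m / exp x) \<longlongrightarrow> (0::real)) at_top"
      by (rule tendsto_power_div_exp_0)
    then have "((\<lambda>h. inverse h ^ Suc m / exp (inverse h)) \<longlongrightarrow> (0::real)) (at_right 0)"
      by (rule filterlim_compose) (rule filterlim_inverse_at_top_right)
    moreover have "\<forall>\<^sub>F h in at_right 0. inverse h ^ Suc m / exp (inverse h) = exp_inv m (h::real) / h"
      using eventually_at_right_less[of 0]
      by eventually_elim (simp add: exp_inv_def exp_minus field_simps)
    ultimately show "((\<lambda>h. exp_inv m h / h) \<longlongrightarrow> 0) (at_right 0)"
      by (rule Lim_transform_eventually)
  qed
  then have "(exp_inv m has_field_derivative 0) (at 0)"
    by (simp add: DERIV_def exp_inv_def)
  then show ?thesis using equal by (simp add: exp_inv_def)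
next
  case greater
  have "((\<lambda>t. exp (- (1 / t)) / t ^ m) has_field_derivative
      (exp (- (1 / t)) * (1 / t\<^sup>2) * t ^ m - exp (- (1 / t)) * (real m * t ^ (m - Suc 0))) / (t ^ m * t ^ m)) (at t)"
    using greater by (auto intro!: derivative_eq_intros simp: power2_eq_square)
  \<comment> \<open>Subtraction is truncated at \<open>m = 0\<close>, where the factor
    \<open>real m\<close> makes both sides vanish.\<close>
  moreover have "real m * t ^ (m - Suc 0) = real m * t ^ m / t"
    using greater by (cases m) auto
  then have "(exp (- (1 / t)) * (1 / t\<^sup>2) * t ^ m - exp (- (1 / t)) * (real m * t ^ (m - Suc 0))) / (t ^ m * t ^ m)
      = exp_inv (m + 2) t - real m * exp_inv (m + 1) t"
    using greater by (auto simp: exp_inv_def field_simps power2_eq_square)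
  ultimately have "((\<lambda>t. exp (- (1 / t)) / t ^ m) has_field_derivative
      (exp_inv (m + 2) t - real m * exp_inv (m + 1) t)) (at t)"
    by metis
  moreover have "\<forall>\<^sub>F x in nhds t. x > 0"
    using greater eventually_nhds_in_open[of "{0<..}" t] by simp
  then have "\<forall>\<^sub>F x in nhds t. exp_inv m x = exp (- (1 / x)) / x ^ m"
    by eventually_elim (simp add: exp_inv_def)
  ultimately show ?thesis
    by (subst DERIV_cong_ev[OF refl _ refl, of _ "\<lambda>t. exp (- (1 / t)) / t ^ m"])
qed

text \<open>An algebra of functions that contains the bumps and is closed under partial derivatives.\<close>

inductive bump_algebra :: "'d::finite scalar_field \<Rightarrow> bool" where
  const: "bump_algebra (\<lambda>x. c)"
| component: "bump_algebra (\<lambda>x. x $ i)"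
| bump: "bump_algebra (\<lambda>x. exp_inv m (r - (x - c) \<bullet> (x - c)))"
| add: "bump_algebra f \<Longrightarrow> bump_algebra g \<Longrightarrow> bump_algebra (\<lambda>x. f x + g x)"
| mult: "bump_algebra f \<Longrightarrow> bump_algebra g \<Longrightarrow> bump_algebra (\<lambda>x. f x * g x)"

lemma exp_inv_bump_has_derivative:
  fixes c :: "real ^ 'd"
  shows "((\<lambda>x. exp_inv m (r - (x - c) \<bullet> (x - c))) has_derivative
     (\<lambda>h. (exp_inv (m + 2) (r - (x - c) \<bullet> (x - c)) - real m * exp_inv (m + 1) (r - (x - c) \<bullet> (x - c)))
        * (- 2 * ((x - c) \<bullet> h)))) (at x)"
proof -
  have "((\<lambda>x. r - (x - c) \<bullet> (x - c)) has_derivative (\<lambda>h. - 2 * ((x - c) \<bullet> h))) (at x)"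
    by (auto intro!: derivative_eq_intros simp: inner_commute)
  from has_derivative_compose[OF this exp_inv_has_field_derivative[THEN has_field_derivative_imp_has_derivative]]
  show ?thesis by simp
qed

text \<open>Both claims share one induction, because the sum and product rules for
  \<open>partial_deriv\<close> presuppose that the parts are differentiable.\<close>

lemma bump_algebra_differentiable:
  assumes "bump_algebra f"
  shows "f differentiable at x \<and> bump_algebra (partial_deriv i f)"
  using assms
proof (induction arbitrary: x)
  case (const c)
  have "partial_deriv i (\<lambda>x. c) = (\<lambda>x. 0)"
    by (auto simp: partial_deriv_def)
  then show ?case by (simp add: bump_algebra.const)
next
  case (component j)
  have "partial_deriv i (\<lambda>x. x $ j) = (\<lambda>x. if i = j then 1 else 0)"
    by (auto simp: partial_deriv_component)
  then show ?case
    by (simp add: bump_algebra.const bounded_linear_imp_differentiable bounded_linear_vec_nth)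
next
  case (bump m r c)
  let ?E = "\<lambda>m x. exp_inv m (r - (x - c) \<bullet> (x - c))"
  \<comment> \<open>Differences are spelled as sums with negated constants, so that the introduction
    rules of \<open>bump_algebra\<close> match.\<close>
  have "partial_deriv i (?E m) = (\<lambda>x. (?E (m + 2) x + (- real m) * ?E (m + 1) x) * ((- 2) * (x $ i + - (c $ i))))"
    by (rule ext, subst partial_deriv_eqI[OF exp_inv_bump_has_derivative]) (simp add: inner_axis)
  moreover have "bump_algebra \<dots>"
    by (intro bump_algebra.intros)
  ultimately show ?case
    using differentiableI[OF exp_inv_bump_has_derivative] by auto
next
  case (add f g)
  have "partial_deriv i (\<lambda>x. f x + g x) = (\<lambda>x. partial_deriv i f x + partial_deriv i g x)"
    using add.IH by (auto simp: partial_deriv_add)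
  then show ?case using add.IH by (auto intro: bump_algebra.add)
next
  case (mult f g)
  have "partial_deriv i (\<lambda>x. f x * g x) = (\<lambda>x. f x * partial_deriv i g x + partial_deriv i f x * g x)"
    using mult.IH by (auto simp: partial_deriv_mult)
  moreover have "bump_algebra \<dots>"
    using mult.IH mult.hyps by (intro bump_algebra.add bump_algebra.mult) auto
  ultimately show ?case using mult.IH by auto
qed

lemma bump_algebra_imp_Ck: "bump_algebra f \<Longrightarrow> Ck k f"
proof (induction k arbitrary: f)
  case 0
  then show ?case
    using bump_algebra_differentiable
    by (auto intro!: continuous_at_imp_continuous_on differentiable_imp_continuous_within)
next
  case (Suc k)
  then show ?case using bump_algebra_differentiable by auto
qed

lemma bump_algebra_power: "bump_algebra f \<Longrightarrow> bump_algebra (\<lambda>x. f x ^ n)"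
  by (induction n) (auto intro: bump_algebra.intros)

lemma bump_algebra_prod:
  "finite I \<Longrightarrow> (\<And>i. i \<in> I \<Longrightarrow> bump_algebra (f i)) \<Longrightarrow> bump_algebra (\<lambda>x. \<Prod>i\<in>I. f i x)"
  by (induction I rule: finite_induct) (auto intro: bump_algebra.intros)

text \<open>
  If \<open>\<phi> k\<close> is a bump with values in \<open>[0, 1)\<close>, positive exactly on the \<open>k\<close>-th of countably many balls
  that exhaust \<open>T\<close>, then \<open>1 - (\<Prod>k\<le>n. (1 - \<phi> k) ^ n)\<close> converges to the indicator of \<open>T\<close>.
\<close>

lemma open_indicator_limit_test_functions:
  fixes T :: "(real ^ 'd::finite) set"
  assumes "open T"
  obtains \<psi> where "\<And>n. \<psi> n \<in> test_functions T" "\<And>n x. 0 \<le> \<psi> n x \<and> \<psi> n x \<le> (1::real)"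
    and "\<And>x. (\<lambda>n. \<psi> n x) \<longlonglongrightarrow> indicator T x"
proof (cases "T = {}")
  case True
  show thesis
    by (rule that[of "\<lambda>n x. 0"])
      (auto simp: True test_functions_def intro: bump_algebra_imp_Ck bump_algebra.const)
next
  case False
  \<comment> \<open>Requiring the closed balls to lie in \<open>T\<close> keeps the closures of the
    supports inside \<open>T\<close>.\<close>
  define B where "B = {p :: (real ^ 'd) \<times> real. snd p > 0 \<and> cball (fst p) (snd p) \<subseteq> T}"
  have "\<exists>D. countable D \<and> D \<subseteq> B \<and> (\<Union>p\<in>D. ball (fst p) (snd p)) = (\<Union>p\<in>B. ball (fst p) (snd p))"
  proof -
    obtain F where F: "F \<subseteq> (\<lambda>p. ball (fst p) (snd p)) ` B" "countable F"
      "\<Union>F = \<Union> ((\<lambda>p. ball (fst p) (snd p)) ` B)"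
      by (rule Lindelof[of "(\<lambda>p. ball (fst p) (snd p)) ` B"]) auto
    from countable_subset_image[THEN iffD1, of F "(\<lambda>p. ball (fst p) (snd p))" B] F
    obtain D where "countable D" "D \<subseteq> B" "F = (\<lambda>p. ball (fst p) (snd p)) ` D" by auto
    with F show ?thesis by auto
  qed
  then obtain D where D: "countable D" "D \<subseteq> B"
    and D_Un: "(\<Union>p\<in>D. ball (fst p) (snd p)) = (\<Union>p\<in>B. ball (fst p) (snd p))"
    by blast
  have T_sub: "x \<in> (\<Union>p\<in>D. ball (fst p) (snd p))" if "x \<in> T" for x
  proof -
    obtain e where "e > 0" "cball x e \<subseteq> T"
      using \<open>x \<in> T\<close> assms open_contains_cball by blast
    then have "(x, e) \<in> B" "x \<in> ball x e" by (auto simp: B_def)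
    then show ?thesis unfolding D_Un by force
  qed
  then have "D \<noteq> {}" using False by blast
  
  \<comment> \<open>If \<open>D\<close> is finite, \<open>from_nat_into\<close> repeats a centre and
    radius, which does no harm to the cover.\<close>
  define c where "c k = fst (from_nat_into D k)" for k
  define r where "r k = snd (from_nat_into D k)" for k
  have r_pos: "r k > 0" and ball_T: "cball (c k) (r k) \<subseteq> T" for k
    using from_nat_into[OF \<open>D \<noteq> {}\<close>, of k] D(2) by (auto simp: B_def c_def r_def)
  have T_cover: "\<exists>k. x \<in> ball (c k) (r k)" if x: "x \<in> T" for x
  proof -
    obtain q where q: "q \<in> D" "x \<in> ball (fst q) (snd q)" using T_sub[OF x] by (rule UN_E)
    obtain k where "from_nat_into D k = q" using from_nat_into_surj[OF D(1) q(1)] by (rule exE)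
    then show ?thesis using q(2) unfolding c_def r_def by (intro exI[of _ k]) simp
  qed
  define \<phi> where "\<phi> k x = exp_inv 0 ((r k)\<^sup>2 - (x - c k) \<bullet> (x - c k))" for k x
  have \<phi>_pos_iff: "\<phi> k x > 0 \<longleftrightarrow> x \<in> ball (c k) (r k)" for k x
  proof -
    have "(r k)\<^sup>2 - (x - c k) \<bullet> (x - c k) > 0 \<longleftrightarrow> norm (x - c k) < r k"
      using r_pos[of k] abs_le_square_iff[of "r k" "norm (x - c k)"]
      by (simp add: power2_norm_eq_inner) linarith
    then show ?thesis by (auto simp: \<phi>_def exp_inv_def dist_norm norm_minus_commute)
  qed
  have \<phi>_bounds: "0 \<le> \<phi> k x" "\<phi> k x < 1" for k x
    by (auto simp: \<phi>_def exp_inv_def)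
  \<comment> \<open>The exponent \<open>n\<close> is essential: a single factor
    \<open>1 - \<phi> k x\<close> may be close to 1, and only its powers tend to 0. Increasing the
    range of the product along with it brings in every ball eventually.\<close>
  define \<psi> where "\<psi> n x = 1 + (- 1) * (\<Prod>k\<le>n. (1 + (- 1) * \<phi> k x) ^ n)" for n x
  have bump_\<psi>: "bump_algebra (\<psi> n)" for n
    unfolding \<psi>_def \<phi>_def
    by (intro bump_algebra.add bump_algebra.mult bump_algebra.const bump_algebra_prod
        bump_algebra_power bump_algebra.bump) auto
  have prod_bounds: "0 \<le> (\<Prod>k\<le>n. (1 - \<phi> k x) ^ n)" "(\<Prod>k\<le>n. (1 - \<phi> k x) ^ n) \<le> 1" for n x
    using \<phi>_bounds by (auto intro!: prod_nonneg prod_le_1 power_le_one zero_le_power simp: less_imp_le)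
  have supp: "closure {x. \<psi> n x \<noteq> 0} \<subseteq> (\<Union>k\<le>n. cball (c k) (r k))" for n
  proof (rule closure_minimal)
    show "{x. \<psi> n x \<noteq> 0} \<subseteq> (\<Union>k\<le>n. cball (c k) (r k))"
    proof
      fix x assume "x \<in> {x. \<psi> n x \<noteq> 0}"
      then have "(\<Prod>k\<le>n. (1 - \<phi> k x) ^ n) \<noteq> 1" by (simp add: \<psi>_def)
      then have "\<not> (\<forall>k\<in>{..n}. (1 - \<phi> k x) ^ n = 1)"
        using prod.neutral[of "{..n}" "\<lambda>k. (1 - \<phi> k x) ^ n"] by argo
      then obtain k where "k \<le> n" "(1 - \<phi> k x) ^ n \<noteq> 1"
        unfolding ball_simps by (elim bexE) auto
      then have "\<phi> k x \<noteq> 0" by auto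
      then have "x \<in> ball (c k) (r k)"
        using \<phi>_pos_iff[of k x] \<phi>_bounds(1)[of k x] by simp
      with \<open>k \<le> n\<close> show "x \<in> (\<Union>k\<le>n. cball (c k) (r k))" by (force simp: ball_def)
    qed
    show "closed (\<Union>k\<le>n. cball (c k) (r k))" by (intro closed_UN) auto
  qed
  have supp_compact: "compact (\<Union>k\<le>n. cball (c k) (r k))" for n
    by (intro compact_UN) auto
  show thesis
  proof
    fix n
    have "compact (closure {x. \<psi> n x \<noteq> 0})"
      using compact_Int_closed[OF supp_compact[of n] closed_closure[of "{x. \<psi> n x \<noteq> 0}"]] supp[of n]
      by (simp add: Int_absorb1)
    moreover have "(\<Union>k\<le>n. cball (c k) (r k)) \<subseteq> T" using ball_T by blast
    ultimately show "\<psi> n \<in> test_functions T"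
      using supp[of n] bump_algebra_imp_Ck[OF bump_\<psi>] by (auto simp: test_functions_def)
    show "0 \<le> \<psi> n x \<and> \<psi> n x \<le> 1" for x
      using prod_bounds[of x n] by (simp add: \<psi>_def)
  next
    fix x
    show "(\<lambda>n. \<psi> n x) \<longlonglongrightarrow> indicator T x"
    proof (cases "x \<in> T")
      case True
      then obtain k0 where "x \<in> ball (c k0) (r k0)" using T_cover by blast
      then have k0: "0 < \<phi> k0 x" by (simp add: \<phi>_pos_iff)
      have lim: "(\<lambda>n. (1 - \<phi> k0 x) ^ n) \<longlonglongrightarrow> 0"
        using k0 \<phi>_bounds(2)[of k0 x] by (intro LIMSEQ_power_zero) auto
      have ev: "\<forall>\<^sub>F n in sequentially. (\<Prod>k\<le>n. (1 - \<phi> k x) ^ n) \<le> (1 - \<phi> k0 x) ^ n"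
        using eventually_ge_at_top[of k0]
      proof eventually_elim
        case (elim n)
        have "(\<Prod>k\<le>n. (1 - \<phi> k x) ^ n) = (1 - \<phi> k0 x) ^ n * (\<Prod>k\<in>{..n} - {k0}. (1 - \<phi> k x) ^ n)"
          using elim by (subst prod.remove[of _ k0]) auto
        also have "\<dots> \<le> (1 - \<phi> k0 x) ^ n * 1"
          using \<phi>_bounds(1) \<phi>_bounds(2)[THEN less_imp_le]
          by (intro mult_left_mono prod_le_1 zero_le_power conjI power_le_one) auto
        finally show ?case by simp
      qed
      have "(\<lambda>n. \<Prod>k\<le>n. (1 - \<phi> k x) ^ n) \<longlonglongrightarrow> 0"
        by (rule tendsto_sandwich[OF _ ev tendsto_const lim]) (intro always_eventually allI prod_bounds)
      from tendsto_diff[OF tendsto_const[of 1] this]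
      show ?thesis using True by (simp add: \<psi>_def)
    next
      case False
      have "\<phi> k x = 0" for k
      proof -
        have "x \<notin> ball (c k) (r k)" using False ball_T[of k] ball_subset_cball by blast
        then show ?thesis using \<phi>_pos_iff[of k x] \<phi>_bounds(1)[of k x] by simp
      qed
      then show ?thesis using False by (simp add: \<psi>_def)
    qed
  qed
qed

subsection \<open>Integration by parts and the Poincare inequality\<close>

lemma differentiable_imp_continuous_on_UNIV:
  fixes f :: "'a::euclidean_space \<Rightarrow> real"
  assumes "\<And>x. f differentiable (at x)"
  shows "continuous_on UNIV f"
  using assms by (auto intro!: continuous_at_imp_continuous_on differentiable_imp_continuous_within)

lemma integrable_compact_support:
  fixes f :: "'a::euclidean_space \<Rightarrow> real"
  assumes "continuous_on UNIV f" "compact K" "\<And>x. x \<notin> K \<Longrightarrow> f x = 0"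
  shows "integrable lborel f"
proof -
  have "integrable lborel (\<lambda>x. indicator K x *\<^sub>R f x)"
    using assms by (intro borel_integrable_compact continuous_on_subset[OF assms(1)]) auto
  also have "(\<lambda>x. indicator K x *\<^sub>R f x) = f"
    using assms(3) by (auto simp: fun_eq_iff indicator_def)
  finally show ?thesis .
qed

lemma has_real_derivative_along_axis:
  fixes f :: "'d::finite scalar_field"
  assumes "\<And>x. f differentiable (at x)"
  shows "((\<lambda>t. f (x + t *\<^sub>R axis i 1)) has_real_derivative partial_deriv i f (x + t *\<^sub>R axis i 1)) (at t)"
proof -
  have "((\<lambda>t. x + t *\<^sub>R axis i 1) has_derivative (\<lambda>h. h *\<^sub>R axis i 1)) (at t)"
    by (auto intro!: derivative_eq_intros)
  from has_derivative_compose[OF this assms[unfolded frechet_derivative_works]]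
  have "((\<lambda>t. f (x + t *\<^sub>R axis i 1)) has_derivative
      (\<lambda>h. frechet_derivative f (at (x + t *\<^sub>R axis i 1)) (h *\<^sub>R axis i 1))) (at t)" .
  moreover have "frechet_derivative f (at y) (h *\<^sub>R axis i 1) = partial_deriv i f y * h" for y h
    using linear_frechet_derivative[OF assms[of y]] by (simp add: partial_deriv_def linear_cmul)
  ultimately show ?thesis by (simp add: has_field_derivative_def)
qed

lemma partial_deriv_eq_0_outside:
  assumes "closed K" "\<And>x. x \<notin> K \<Longrightarrow> f x = 0" "x \<notin> K"
  shows "partial_deriv i f x = 0"
proof -
  have "((\<lambda>_. 0) has_derivative (\<lambda>_. 0)) (at x)" by simp
  then have "(f has_derivative (\<lambda>_. 0)) (at x)"
    by (rule has_derivative_transform_within_open[of _ _ _ _ "- K"]) (use assms in auto)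
  from partial_deriv_eqI[OF this] show ?thesis .
qed

text \<open>
  The integral of the difference quotient vanishes by translation invariance, and the difference
  quotients converge boundedly to the partial derivative.
\<close>

lemma integral_partial_deriv_eq_0:
  fixes f :: "'d::finite scalar_field"
  assumes diff: "\<And>x. f differentiable (at x)" and cont: "continuous_on UNIV (partial_deriv i f)"
    and K: "compact K" and supp: "\<And>x. x \<notin> K \<Longrightarrow> f x = 0"
  shows "(\<integral>x. partial_deriv i f x \<partial>lborel) = 0"
proof -
  define e where "e = (axis i 1 :: real ^ 'd)"
  have norm_e: "norm e = 1" by (simp add: e_def)
  define h where "h n = inverse (real (Suc n))" for n
  have h_pos: "0 < h n" "h n \<le> 1" for n by (auto simp: h_def divide_simps)
  have h_0: "h \<longlonglongrightarrow> 0" unfolding h_def by (rule LIMSEQ_inverse_real_of_nat)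
  define q where "q n x = (f (x + h n *\<^sub>R e) - f x) / h n" for n x
  have f_int: "integrable lborel f"
    using differentiable_imp_continuous_on_UNIV[OF diff] K supp by (rule integrable_compact_support)
  obtain B where B: "\<And>x. \<bar>partial_deriv i f x\<bar> \<le> B" and "B \<ge> 0"
  proof -
    have "bounded (partial_deriv i f ` K)"
      using K cont by (intro compact_imp_bounded compact_continuous_image) (auto intro: continuous_on_subset)
    then obtain B where B: "B > 0" "\<And>x. x \<in> K \<Longrightarrow> \<bar>partial_deriv i f x\<bar> \<le> B"
      by (auto simp: bounded_pos)
    have "\<bar>partial_deriv i f x\<bar> \<le> B" for x
      using B partial_deriv_eq_0_outside[OF compact_imp_closed[OF K] supp, where x = x and i = i]
      by (cases "x \<in> K") auto
    then show thesis using B(1) by (intro that[of B]) auto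
  qed
  obtain R where R: "K \<subseteq> cball 0 R"
  proof -
    obtain R where "\<forall>x\<in>K. norm x \<le> R" using compact_imp_bounded[OF K] unfolding bounded_iff by auto
    then show thesis by (intro that[of R]) auto
  qed
  \<comment> \<open>The mean value theorem transfers the bound on the derivative to all quotients,
    uniformly in \<open>n\<close>, and makes a quotient vanish where the segment misses
    \<open>K\<close>. As steps are at most 1, a ball of radius \<open>R + 1\<close> carries the
    majorant.\<close>
  have mvt: "\<exists>t. 0 < t \<and> t < h n \<and> q n x = partial_deriv i f (x + t *\<^sub>R e)" for n x
  proof -
    have "\<exists>t. 0 < t \<and> t < h n \<and> f (x + h n *\<^sub>R e) - f (x + 0 *\<^sub>R e) = (h n - 0) * partial_deriv i f (x + t *\<^sub>R e)"
      unfolding e_def by (rule MVT2[OF h_pos(1)]) (rule has_real_derivative_along_axis[OF diff])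
    then show ?thesis using h_pos[of n] by (auto simp: q_def)
  qed
  have q_integral: "(\<integral>x. q n x \<partial>lborel) = 0" for n
  proof -
    have int: "integrable lborel (\<lambda>x. f (h n *\<^sub>R e + x))"
      using f_int by (subst (asm) lborel_distr_plus[of "h n *\<^sub>R e", symmetric])
        (subst (asm) integrable_distr_eq, auto intro!: borel_measurable_continuous_onI differentiable_imp_continuous_on_UNIV diff)
    have eq: "(\<integral>x. f (h n *\<^sub>R e + x) \<partial>lborel) = (\<integral>x. f x \<partial>lborel)"
      by (subst (2) lborel_distr_plus[of "h n *\<^sub>R e", symmetric], subst integral_distr)
        (auto intro!: borel_measurable_continuous_onI differentiable_imp_continuous_on_UNIV diff)
    show ?thesis
      using int eq f_int by (simp add: q_def add.commute)
  qed
  have "(\<lambda>n. \<integral>x. q n x \<partial>lborel) \<longlonglongrightarrow> (\<integral>x. partial_deriv i f x \<partial>lborel)"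
  proof (rule integral_dominated_convergence)
    show "partial_deriv i f \<in> borel_measurable lborel"
      using cont by (simp add: borel_measurable_continuous_onI)
    show "q n \<in> borel_measurable lborel" for n
    proof -
      have "continuous_on UNIV (\<lambda>x. f (x + h n *\<^sub>R e))"
        by (rule continuous_on_compose2[OF differentiable_imp_continuous_on_UNIV[OF diff]])
          (auto intro!: continuous_intros)
      then have "continuous_on UNIV (q n)"
        using h_pos(1)[of n] differentiable_imp_continuous_on_UNIV[OF diff] unfolding q_def
        by (intro continuous_intros) auto
      then show ?thesis by (simp add: borel_measurable_continuous_onI)
    qed
    show "integrable lborel (\<lambda>x. indicator (cball 0 (R + 1)) x *\<^sub>R B :: real)"
      by (rule borel_integrable_compact) auto
    show "AE x in lborel. (\<lambda>n. q n x) \<longlonglongrightarrow> partial_deriv i f x"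
    proof (rule AE_I2)
      fix x
      have "((\<lambda>t. (f (x + (0 + t) *\<^sub>R e) - f (x + 0 *\<^sub>R e)) / t) \<longlongrightarrow> partial_deriv i f (x + 0 *\<^sub>R e)) (at 0)"
        using has_real_derivative_along_axis[OF diff, of x i 0] unfolding DERIV_def e_def .
      then have "((\<lambda>t. (f (x + t *\<^sub>R e) - f x) / t) \<longlongrightarrow> partial_deriv i f x) (at 0)"
        by simp
      moreover have "filterlim h (at 0) sequentially"
        using h_0 h_pos by (auto simp: filterlim_at intro!: always_eventually) (metis less_irrefl)
      ultimately show "(\<lambda>n. q n x) \<longlonglongrightarrow> partial_deriv i f x"
        unfolding q_def by (rule filterlim_compose)
    qed
    show "AE x in lborel. norm (q n x) \<le> indicator (cball 0 (R + 1)) x *\<^sub>R B" for n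
    proof (rule AE_I2)
      fix x
      obtain t where t: "0 < t" "t < h n" "q n x = partial_deriv i f (x + t *\<^sub>R e)"
        using mvt by blast
      show "norm (q n x) \<le> indicator (cball 0 (R + 1)) x *\<^sub>R B"
      proof (cases "x \<in> cball 0 (R + 1)")
        case True
        then show ?thesis using t B by simp
      next
        case False
        have "norm x \<le> norm (x + t *\<^sub>R e) + norm (t *\<^sub>R e)"
          using norm_triangle_ineq4[of "x + t *\<^sub>R e" "t *\<^sub>R e"] by simp
        moreover have "norm (t *\<^sub>R e) \<le> 1" using t h_pos(2)[of n] norm_e by simp
        ultimately have "x + t *\<^sub>R e \<notin> cball 0 R" using False by auto
        then have "x + t *\<^sub>R e \<notin> K" using R by blast
        then have "q n x = 0"
          using partial_deriv_eq_0_outside[OF compact_imp_closed[OF K] supp, where x = "x + t *\<^sub>R e" and i = i] t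
          by simp
        then show ?thesis using \<open>B \<ge> 0\<close> by simp
      qed
    qed
  qed
  then show ?thesis by (simp add: q_integral LIMSEQ_const_iff)
qed

section \<open>Test functions and integration over the domain\<close>

lemma test_function_differentiable: "\<phi> \<in> test_functions \<Omega> \<Longrightarrow> \<phi> differentiable (at x)"
proof -
  assume "\<phi> \<in> test_functions \<Omega>"
  then have "Ck (Suc 0) \<phi>" by (auto simp: test_functions_def)
  then show ?thesis by simp
qed

lemma test_function_partial_deriv_continuous:
  "\<phi> \<in> test_functions \<Omega> \<Longrightarrow> continuous_on UNIV (partial_deriv i \<phi>)"
proof -
  assume "\<phi> \<in> test_functions \<Omega>"
  then have "Ck (Suc 0) \<phi>" by (auto simp: test_functions_def)
  then show ?thesis by simp
qed

lemmas test_function_continuous =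
  differentiable_imp_continuous_on_UNIV[OF test_function_differentiable]

lemma test_functionE:
  assumes "\<phi> \<in> test_functions \<Omega>"
  obtains K where "compact K" "K \<subseteq> \<Omega>" "\<And>x. x \<notin> K \<Longrightarrow> \<phi> x = 0"
    "\<And>x i. x \<notin> K \<Longrightarrow> partial_deriv i \<phi> x = 0"
proof
  let ?K = "closure {x. \<phi> x \<noteq> 0}"
  show "compact ?K" "?K \<subseteq> \<Omega>" using assms by (auto simp: test_functions_def)
  show *: "\<phi> x = 0" if "x \<notin> ?K" for x using that closure_subset[of "{x. \<phi> x \<noteq> 0}"] by auto
  show "partial_deriv i \<phi> x = 0" if "x \<notin> ?K" for x i
    by (rule partial_deriv_eq_0_outside[OF closed_closure * that])
qed

text \<open>Bridge between the measure of the definitions and \<open>lborel\<close>, on which the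
  translation argument runs: the indicator of \<Omega> is absorbed by the support, and completing
  the measure leaves integrals of Borel functions unchanged.\<close>

lemma lebesgue_on_integral_supported:
  fixes f :: "real ^ 'd::finite \<Rightarrow> real"
  assumes \<Omega>: "\<Omega> \<in> sets lebesgue" and f: "f \<in> borel_measurable borel" and supp: "\<And>x. x \<notin> \<Omega> \<Longrightarrow> f x = 0"
  shows "integrable (lebesgue_on \<Omega>) f \<longleftrightarrow> integrable lborel f"
    and "(\<integral>x. f x \<partial>lebesgue_on \<Omega>) = (\<integral>x. f x \<partial>lborel)"
proof -
  have eq: "(\<lambda>x. indicat_real \<Omega> x * f x) = f"
    using supp by (auto simp: fun_eq_iff indicator_def)
  show "integrable (lebesgue_on \<Omega>) f \<longleftrightarrow> integrable lborel f"
    using \<Omega> f by (simp add: integrable_restrict_space eq integrable_completion)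
  show "(\<integral>x. f x \<partial>lebesgue_on \<Omega>) = (\<integral>x. f x \<partial>lborel)"
    using \<Omega> f by (simp add: integral_restrict_space eq integral_completion)
qed

lemma compact_support_L2:
  fixes f :: "real ^ 'd::finite \<Rightarrow> real"
  assumes "\<Omega> \<in> sets lebesgue" "continuous_on UNIV f" "compact K" "K \<subseteq> \<Omega>" "\<And>x. x \<notin> K \<Longrightarrow> f x = 0"
  shows "f \<in> L2 \<Omega>"
proof -
  have f: "f \<in> borel_measurable borel" using assms by (simp add: borel_measurable_continuous_onI)
  have "integrable lborel (\<lambda>x. (f x)\<^sup>2)"
    by (rule integrable_compact_support[OF _ assms(3)]) (use assms in \<open>auto intro!: continuous_intros\<close>)
  then have "integrable (lebesgue_on \<Omega>) (\<lambda>x. (f x)\<^sup>2)"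
    using assms by (subst lebesgue_on_integral_supported) (auto intro: f borel_measurable_power)
  moreover have "f \<in> borel_measurable (lebesgue_on \<Omega>)"
    using f by (intro measurable_restrict_space1 measurable_completion) simp
  ultimately show ?thesis by (simp add: L2_def)
qed

lemma test_function_L2:
  assumes "\<Omega> \<in> sets lebesgue" "\<phi> \<in> test_functions \<Omega>"
  shows "\<phi> \<in> L2 \<Omega>" "partial_deriv i \<phi> \<in> L2 \<Omega>"
proof -
  obtain K where "compact K" "K \<subseteq> \<Omega>" "\<And>x. x \<notin> K \<Longrightarrow> \<phi> x = 0"
    "\<And>x i. x \<notin> K \<Longrightarrow> partial_deriv i \<phi> x = 0"
    using test_functionE[OF assms(2)] by metis
  then show "\<phi> \<in> L2 \<Omega>" "partial_deriv i \<phi> \<in> L2 \<Omega>"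
    using assms test_function_continuous[OF assms(2)] test_function_partial_deriv_continuous[OF assms(2)]
    by (auto intro!: compact_support_L2[of \<Omega> _ K])
qed

text \<open>The product of \<open>f\<close> and \<open>\<phi>\<close> has compact support even if
  \<open>f\<close> has not, so its partial derivative integrates to 0. Applied with \<open>f\<close>
  a test function it identifies the weak gradient; with \<open>f\<close> a test function times a
  coordinate it gives the Poincare inequality.\<close>

lemma integration_by_parts:
  fixes f g :: "'d::finite scalar_field"
  assumes "\<Omega> \<in> sets lebesgue" "\<phi> \<in> test_functions \<Omega>"
    and f: "\<And>x. f differentiable (at x)" "continuous_on UNIV (partial_deriv i f)"
  shows "(\<integral>x. f x * partial_deriv i \<phi> x \<partial>lebesgue_on \<Omega>) = - (\<integral>x. partial_deriv i f x * \<phi> x \<partial>lebesgue_on \<Omega>)"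
proof -
  obtain K where K: "compact K" "K \<subseteq> \<Omega>" "\<And>x. x \<notin> K \<Longrightarrow> \<phi> x = 0"
    "\<And>x i. x \<notin> K \<Longrightarrow> partial_deriv i \<phi> x = 0"
    using test_functionE[OF assms(2)] by metis
  note cont = f(2) differentiable_imp_continuous_on_UNIV[OF f(1)] test_function_continuous[OF assms(2)]
    test_function_partial_deriv_continuous[OF assms(2)]
  have c1: "continuous_on UNIV (\<lambda>x. f x * partial_deriv i \<phi> x)"
    and c2: "continuous_on UNIV (\<lambda>x. partial_deriv i f x * \<phi> x)"
    by (intro continuous_intros cont)+
  have i1: "integrable lborel (\<lambda>x. f x * partial_deriv i \<phi> x)"
    and i2: "integrable lborel (\<lambda>x. partial_deriv i f x * \<phi> x)"
    using K by (auto intro!: integrable_compact_support[OF _ K(1)] c1 c2)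
  have pd: "partial_deriv i (\<lambda>x. f x * \<phi> x) = (\<lambda>x. f x * partial_deriv i \<phi> x + partial_deriv i f x * \<phi> x)"
    using f test_function_differentiable[OF assms(2)] by (auto simp: partial_deriv_mult)
  have "(\<integral>x. partial_deriv i (\<lambda>x. f x * \<phi> x) x \<partial>lborel) = 0"
    using K f test_function_differentiable[OF assms(2)]
    by (intro integral_partial_deriv_eq_0[of _ _ K]) (auto simp: pd intro!: continuous_intros cont)
  then have "(\<integral>x. f x * partial_deriv i \<phi> x \<partial>lborel) = - (\<integral>x. partial_deriv i f x * \<phi> x \<partial>lborel)"
    using i1 i2 by (simp add: pd)
  then show ?thesis
    using K assms(1) c1 c2
    by (subst (1 2) lebesgue_on_integral_supported) (auto intro!: borel_measurable_continuous_onI)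
qed

text \<open>Integrate \<open>\<phi>\<^sup>2 * \<partial>\<^sub>i x\<^sub>i\<close> by parts.\<close>

lemma Poincare_test_function:
  fixes \<phi> :: "'d::finite scalar_field"
  assumes \<Omega>: "\<Omega> \<in> sets lebesgue" and bound: "\<And>x. x \<in> \<Omega> \<Longrightarrow> \<bar>x $ i\<bar> \<le> R" and \<phi>: "\<phi> \<in> test_functions \<Omega>"
  shows "L2_inner \<Omega> \<phi> \<phi> \<le> 4 * R\<^sup>2 * L2_inner \<Omega> (partial_deriv i \<phi>) (partial_deriv i \<phi>)"
proof -
  obtain K where K: "compact K" "K \<subseteq> \<Omega>" "\<And>x. x \<notin> K \<Longrightarrow> \<phi> x = 0"
    "\<And>x i. x \<notin> K \<Longrightarrow> partial_deriv i \<phi> x = 0"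
    using test_functionE[OF \<phi>] by metis
  note cont = test_function_continuous[OF \<phi>] test_function_partial_deriv_continuous[OF \<phi>]
  define \<psi> where "\<psi> x = x $ i * partial_deriv i \<phi> x" for x
  have \<psi>_cont: "continuous_on UNIV \<psi>"
    unfolding \<psi>_def by (intro continuous_intros cont)
  have L2s: "\<phi> \<in> L2 \<Omega>" "partial_deriv i \<phi> \<in> L2 \<Omega>" "\<psi> \<in> L2 \<Omega>"
    using test_function_L2[OF \<Omega> \<phi>] K(4) unfolding \<psi>_def
    by (auto intro!: compact_support_L2[OF \<Omega> _ K(1,2)] continuous_intros cont)
  have diff: "(\<lambda>x. x $ i) differentiable at x" for x :: "real ^ 'd"
    by (simp add: bounded_linear_imp_differentiable bounded_linear_vec_nth)
  have pd: "partial_deriv i (\<lambda>x. x $ i * \<phi> x) = (\<lambda>x. \<psi> x + \<phi> x)"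
    using diff test_function_differentiable[OF \<phi>]
    by (auto simp: partial_deriv_mult partial_deriv_component \<psi>_def)
  have "(\<integral>x. x $ i * \<phi> x * partial_deriv i \<phi> x \<partial>lebesgue_on \<Omega>) = - (\<integral>x. (\<psi> x + \<phi> x) * \<phi> x \<partial>lebesgue_on \<Omega>)"
    using integration_by_parts[OF \<Omega> \<phi>, of "\<lambda>x. x $ i * \<phi> x" i, unfolded pd]
      diff test_function_differentiable[OF \<phi>] \<psi>_cont by (auto intro!: continuous_intros cont)
  moreover have "(\<integral>x. x $ i * \<phi> x * partial_deriv i \<phi> x \<partial>lebesgue_on \<Omega>) = L2_inner \<Omega> \<psi> \<phi>"
    by (simp add: L2_inner_def \<psi>_def mult.commute mult.left_commute)
  moreover have "(\<integral>x. (\<psi> x + \<phi> x) * \<phi> x \<partial>lebesgue_on \<Omega>) = L2_inner \<Omega> \<psi> \<phi> + L2_inner \<Omega> \<phi> \<phi>"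
    using L2_inner_add_left[OF L2s(3,1,1)] by (simp add: L2_inner_def)
  \<comment> \<open>The term \<open>L2_inner \<Omega> \<psi> \<phi>\<close> occurs on both sides
    with opposite signs, hence the factor 2. Its square and \<open>\<bar>x $ i\<bar> \<le> R\<close>
    produce the constant \<open>4 * R\<^sup>2\<close>.\<close>
  ultimately have eq: "L2_inner \<Omega> \<phi> \<phi> = - 2 * L2_inner \<Omega> \<psi> \<phi>" by simp
  let ?a = "L2_inner \<Omega> \<phi> \<phi>" and ?b = "L2_inner \<Omega> \<psi> \<psi>"
  have "?a\<^sup>2 = 4 * (L2_inner \<Omega> \<psi> \<phi>)\<^sup>2" unfolding eq by (simp add: power2_eq_square)
  then have "?a\<^sup>2 \<le> 4 * (?b * ?a)"
    using L2_Cauchy_Schwarz[OF L2s(3,1)] by linarith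
  then have "?a * ?a \<le> 4 * ?b * ?a" by (simp add: power2_eq_square)
  then have "?a \<le> 4 * ?b"
    using L2_inner_self_nonneg[of \<Omega> \<phi>] L2_inner_self_nonneg[of \<Omega> \<psi>]
    by (cases "?a = 0") (auto simp: mult_le_cancel_right)
  also have "?b \<le> R\<^sup>2 * L2_inner \<Omega> (partial_deriv i \<phi>) (partial_deriv i \<phi>)"
  proof -
    have "?b \<le> L2_inner \<Omega> (\<lambda>x. R * partial_deriv i \<phi> x) (\<lambda>x. R * partial_deriv i \<phi> x)"
      unfolding L2_inner_def
    proof (rule integral_mono)
      fix x assume "x \<in> space (lebesgue_on \<Omega>)"
      then have "\<bar>x $ i\<bar> \<le> \<bar>R\<bar>" using bound[of x] \<Omega> by (simp add: space_restrict_space)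
      then have "(x $ i)\<^sup>2 \<le> R\<^sup>2" by (simp only: abs_le_square_iff)
      then have "(x $ i)\<^sup>2 * (partial_deriv i \<phi> x)\<^sup>2 \<le> R\<^sup>2 * (partial_deriv i \<phi> x)\<^sup>2"
        by (rule mult_right_mono) simp
      then show "\<psi> x * \<psi> x \<le> R * partial_deriv i \<phi> x * (R * partial_deriv i \<phi> x)"
        by (simp add: \<psi>_def power2_eq_square mult_ac)
    qed (use L2s in \<open>auto intro!: integrable_mult_L2 L2_cmult\<close>)
    then show ?thesis by (simp add: L2_inner_cmult_left L2_inner_cmult_right power2_eq_square mult_ac)
  qed
  finally show ?thesis by simp
qed

subsection \<open>The fundamental lemma of the calculus of variations\<close>

lemma test_functions_mono: "S \<subseteq> T \<Longrightarrow> test_functions S \<subseteq> test_functions T"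
  by (auto simp: test_functions_def)

text \<open>Dominated convergence with majorant \<open>\<bar>g\<bar>\<close> carries the hypothesis
  from test functions to indicators of open sets, and from these to countable intersections of open
  sets. A Lebesgue set differs from such an intersection by a null set, so \<open>g\<close> has
  integral 0 over every measurable subset of \<Omega>.\<close>

lemma fundamental_lemma:
  fixes g :: "real ^ 'd::finite \<Rightarrow> real"
  assumes \<Omega>: "open \<Omega>" and g: "integrable (lebesgue_on \<Omega>) g"
    and zero: "\<And>\<phi>. \<phi> \<in> test_functions \<Omega> \<Longrightarrow> (\<integral>x. \<phi> x * g x \<partial>lebesgue_on \<Omega>) = 0"
  shows "AE x in lebesgue_on \<Omega>. g x = 0"
proof -
  have \<Omega>_sets: "\<Omega> \<in> sets lebesgue" using \<Omega> by auto
  have [measurable]: "g \<in> borel_measurable (lebesgue_on \<Omega>)" using g by auto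
  have open_meas: "indicat_real T \<in> borel_measurable (lebesgue_on \<Omega>)" if "open T" for T
    using that by (intro measurable_restrict_space1 borel_measurable_indicator) auto
  have open_zero: "(\<integral>x. indicator T x * g x \<partial>lebesgue_on \<Omega>) = 0" if T: "open T" "T \<subseteq> \<Omega>" for T
  proof -
    obtain \<psi> where \<psi>: "\<And>n. \<psi> n \<in> test_functions T" "\<And>n x. 0 \<le> \<psi> n x \<and> \<psi> n x \<le> (1::real)"
      "\<And>x. (\<lambda>n. \<psi> n x) \<longlonglongrightarrow> indicator T x"
      using open_indicator_limit_test_functions[OF T(1)] by blast
    have \<psi>_test: "\<psi> n \<in> test_functions \<Omega>" for n using \<psi>(1)[of n] test_functions_mono[OF T(2)] by blast
    have \<psi>_meas[measurable]: "\<psi> n \<in> borel_measurable (lebesgue_on \<Omega>)" for n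
      using test_function_L2(1)[OF \<Omega>_sets \<psi>_test] by (rule L2_measurable)
    have "(\<lambda>n. \<integral>x. \<psi> n x * g x \<partial>lebesgue_on \<Omega>) \<longlonglongrightarrow> (\<integral>x. indicator T x * g x \<partial>lebesgue_on \<Omega>)"
    proof (rule integral_dominated_convergence[where w = "\<lambda>x. \<bar>g x\<bar>"])
      show "AE x in lebesgue_on \<Omega>. (\<lambda>n. \<psi> n x * g x) \<longlonglongrightarrow> indicator T x * g x"
        by (intro AE_I2 tendsto_mult_right \<psi>(3))
      show "AE x in lebesgue_on \<Omega>. norm (\<psi> n x * g x) \<le> \<bar>g x\<bar>" for n
        using \<psi>(2)[of n] by (intro AE_I2) (simp add: abs_mult mult_left_le_one_le)
    qed (use g open_meas[OF T(1)] in auto)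
    then show ?thesis using zero[OF \<psi>_test] by (simp add: LIMSEQ_const_iff)
  qed
  show ?thesis
  proof (rule density_unique_real[OF g, of "\<lambda>_. 0"])
    fix A assume A: "A \<in> sets (lebesgue_on \<Omega>)"
    then have A': "A \<in> sets lebesgue" "A \<subseteq> \<Omega>"
      using \<Omega>_sets by (auto simp: sets_restrict_space_iff)
    obtain C N where C: "gdelta C" "N \<in> null_sets lebesgue" "A \<union> N = C"
      using lebesgue_set_almost_gdelta[OF A'(1)] by metis
    from C(1) obtain F :: "nat \<Rightarrow> (real ^ 'd) set" where F: "\<And>n. open (F n)" "C = (\<Inter>n. F n)"
      by (auto elim: gdelta.cases)
    \<comment> \<open>Finite intersections, cut down to \<Omega>, are open and decrease to the part
      of \<open>C\<close> inside \<Omega>.\<close>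
    define G where "G n = \<Omega> \<inter> (\<Inter>i\<le>n. F i)" for n
    have G: "open (G n)" "G n \<subseteq> \<Omega>" for n
      using \<Omega> F(1) by (auto simp: G_def intro!: open_Int open_INT)
    have G_lim: "(\<lambda>n. indicat_real (G n) x) \<longlonglongrightarrow> indicat_real C x" if "x \<in> \<Omega>" for x
    proof (cases "x \<in> C")
      case True
      then have "indicat_real (G n) x = indicat_real C x" for n
        using that F(2) by (auto simp: G_def indicator_def)
      then show ?thesis by simp
    next
      case False
      then obtain j where "x \<notin> F j" using F(2) by blast
      then have "indicat_real (G n) x = indicat_real C x" if "n \<ge> j" for n
        using that False by (auto simp: G_def indicator_def)
      then show ?thesis
        by (intro tendsto_eventually eventually_mono[OF eventually_ge_at_top[of j]])
    qed
    have "AE x in lebesgue. x \<notin> N" using C(2) by (rule AE_not_in)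
    then have AE_N: "AE x in lebesgue_on \<Omega>. x \<notin> N" using \<Omega>_sets by (auto simp: AE_restrict_space_iff)
    have "(\<lambda>n. \<integral>x. indicator (G n) x * g x \<partial>lebesgue_on \<Omega>) \<longlonglongrightarrow> (\<integral>x. indicator A x * g x \<partial>lebesgue_on \<Omega>)"
    proof (rule integral_dominated_convergence[where w = "\<lambda>x. \<bar>g x\<bar>"])
      show "AE x in lebesgue_on \<Omega>. (\<lambda>n. indicator (G n) x * g x) \<longlonglongrightarrow> indicator A x * g x"
        using AE_N AE_space
      proof eventually_elim
        case (elim x)
        then have "x \<in> \<Omega>" "indicat_real C x = indicat_real A x"
          using C(3) by (auto simp: space_restrict_space indicator_def)
        then show ?case using G_lim[of x] by (intro tendsto_mult_right) simp
      qed
      show "AE x in lebesgue_on \<Omega>. norm (indicator (G n) x * g x) \<le> \<bar>g x\<bar>" for n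
        by (intro AE_I2) (simp add: indicator_def)
      show "(\<lambda>x. indicator A x * g x) \<in> borel_measurable (lebesgue_on \<Omega>)"
        using A by auto
    qed (use g open_meas[OF G(1)] in auto)
    then have "(\<integral>x. indicator A x * g x \<partial>lebesgue_on \<Omega>) = 0"
      using open_zero[OF G] by (simp add: LIMSEQ_const_iff)
    then show "(\<integral>x\<in>A. g x \<partial>lebesgue_on \<Omega>) = (\<integral>x\<in>A. 0 \<partial>lebesgue_on \<Omega>)"
      by (simp add: set_lebesgue_integral_def)
  qed simp
qed

text \<open>On a set of finite measure \<open>1 + u\<^sup>2\<close> is an integrable majorant. This
  makes the fundamental lemma, stated for integrable functions, applicable to components of weak
  gradients.\<close>

lemma L2_integrable:
  assumes "bounded \<Omega>" "\<Omega> \<in> sets lebesgue" "u \<in> L2 \<Omega>"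
  shows "integrable (lebesgue_on \<Omega>) u"
proof (rule Bochner_Integration.integrable_bound)
  have "\<Omega> \<in> lmeasurable" using assms by (simp add: bounded_set_imp_lmeasurable)
  then have "integrable (lebesgue_on \<Omega>) (\<lambda>x. 1 :: real)"
    using finite_measure.integrable_const finite_measure_lebesgue_on by blast
  then show "integrable (lebesgue_on \<Omega>) (\<lambda>x. 1 + (u x)\<^sup>2)"
    using assms by (auto simp: L2_def)
  have "\<bar>t\<bar> \<le> 1 + t\<^sup>2" for t :: real
    using sum_squares_bound[of "\<bar>t\<bar>" 1] by simp
  then show "AE x in lebesgue_on \<Omega>. norm (u x) \<le> norm (1 + (u x)\<^sup>2)"
    by (intro AE_I2) (simp add: abs_of_nonneg)
qed (use assms in \<open>auto simp: L2_def\<close>)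

subsection \<open>Weak gradients and the Sobolev space \<open>H10\<close>\<close>

lemma weak_gradient_L2: "weak_gradient \<Omega> u g \<Longrightarrow> (\<lambda>x. g x $ i) \<in> L2 \<Omega>"
  by (simp add: weak_gradient_def)

lemma weak_gradient_grad: "u \<in> H1 \<Omega> \<Longrightarrow> weak_gradient \<Omega> u (grad \<Omega> u)"
  unfolding grad_def H1_def by (auto intro: someI[of "weak_gradient \<Omega> u"])

lemma H1_L2: "u \<in> H1 \<Omega> \<Longrightarrow> u \<in> L2 \<Omega>"
  by (simp add: H1_def)

lemma H10_H1: "u \<in> H10 \<Omega> \<Longrightarrow> u \<in> H1 \<Omega>"
  by (simp add: H10_def)

lemma H10_L2: "u \<in> H10 \<Omega> \<Longrightarrow> u \<in> L2 \<Omega>"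
  by (simp add: H10_H1 H1_L2)

lemma H10_tuples_L2: "U \<in> H10_tuples \<Omega> \<Longrightarrow> U i \<in> L2 \<Omega>"
  by (simp add: H10_tuples_def H10_L2)

section \<open>Linear combinations of test functions\<close>

lemma test_functions_add:
  assumes "f \<in> test_functions \<Omega>" "g \<in> test_functions \<Omega>"
  shows "(\<lambda>x. f x + g x) \<in> test_functions \<Omega>"
proof -
  let ?S = "closure {x. f x \<noteq> 0} \<union> closure {x. g x \<noteq> 0}"
  have S: "compact ?S" "?S \<subseteq> \<Omega>" using assms by (auto simp: test_functions_def)
  have "{x. f x + g x \<noteq> 0} \<subseteq> {x. f x \<noteq> 0} \<union> {x. g x \<noteq> 0}" by auto
  then have sub: "closure {x. f x + g x \<noteq> 0} \<subseteq> ?S"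
    using closure_mono by (simp only: flip: closure_Un)
  then have "compact (closure {x. f x + g x \<noteq> 0})"
    using compact_Int_closed[OF S(1) closed_closure[of "{x. f x + g x \<noteq> 0}"]]
    by (simp add: Int_absorb1)
  then show ?thesis using assms S sub by (auto simp: test_functions_def Ck_add)
qed

lemma test_functions_cmult:
  assumes "f \<in> test_functions \<Omega>"
  shows "(\<lambda>x. c * f x) \<in> test_functions \<Omega>"
proof -
  let ?S = "closure {x. f x \<noteq> 0}"
  have S: "compact ?S" "?S \<subseteq> \<Omega>" using assms by (auto simp: test_functions_def)
  have sub: "closure {x. c * f x \<noteq> 0} \<subseteq> ?S" by (rule closure_mono) auto
  then have "compact (closure {x. c * f x \<noteq> 0})"
    using compact_Int_closed[OF S(1) closed_closure[of "{x. c * f x \<noteq> 0}"]]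
    by (simp add: Int_absorb1)
  then show ?thesis using assms S sub unfolding test_functions_def by (auto simp: Ck_cmult)
qed

lemma H1_norm_squared: "(H1_norm \<Omega> u)\<^sup>2 = L2_inner \<Omega> u u + (grad_norm \<Omega> u)\<^sup>2"
  by (simp add: H1_norm_def L2_inner_self_nonneg)

context
  fixes \<Omega> :: "(real ^ 'd::finite) set"
  assumes domain: "bounded_domain \<Omega>"
begin

lemma domain_sets: "\<Omega> \<in> sets lebesgue"
  using domain by (auto simp: bounded_domain_def)

section \<open>Calculus of weak gradients\<close>

lemma weak_gradient_add:
  assumes "u \<in> L2 \<Omega>" "v \<in> L2 \<Omega>" "weak_gradient \<Omega> u g" "weak_gradient \<Omega> v h"
  shows "weak_gradient \<Omega> (\<lambda>x. u x + v x) (\<lambda>x. g x + h x)"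
  using assms domain_sets
  by (auto simp: weak_gradient_def L2_add L2_inner_add_left test_function_L2)

lemma weak_gradient_cmult:
  assumes "weak_gradient \<Omega> u g"
  shows "weak_gradient \<Omega> (\<lambda>x. c * u x) (\<lambda>x. c *\<^sub>R g x)"
  using assms by (auto simp: weak_gradient_def L2_cmult L2_inner_cmult_left)

text \<open>The difference of the components is orthogonal to all test functions. It follows that
  the chosen \<open>grad\<close> may be exchanged for any explicit weak gradient under an
  integral.\<close>

lemma weak_gradient_unique:
  assumes "weak_gradient \<Omega> u g" "weak_gradient \<Omega> u h"
  shows "ae_eq \<Omega> (\<lambda>x. g x $ i) (\<lambda>x. h x $ i)"
proof -
  have L2: "(\<lambda>x. g x $ i) \<in> L2 \<Omega>" "(\<lambda>x. h x $ i) \<in> L2 \<Omega>"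
    using assms by (auto intro: weak_gradient_L2)
  have "AE x in lebesgue_on \<Omega>. g x $ i - h x $ i = 0"
  proof (rule fundamental_lemma)
    show "integrable (lebesgue_on \<Omega>) (\<lambda>x. g x $ i - h x $ i)"
      using domain domain_sets L2 by (intro L2_integrable L2_diff) (auto simp: bounded_domain_def)
    fix \<phi> assume \<phi>: "\<phi> \<in> test_functions \<Omega>"
    have "L2_inner \<Omega> (\<lambda>x. g x $ i - h x $ i) \<phi> = 0"
      using assms \<phi> L2 test_function_L2(1)[OF domain_sets \<phi>]
      by (auto simp: L2_inner_diff_left weak_gradient_def)
    then show "(\<integral>x. \<phi> x * (g x $ i - h x $ i) \<partial>lebesgue_on \<Omega>) = 0"
      by (simp add: L2_inner_def mult.commute)
  qed (use domain in \<open>simp add: bounded_domain_def\<close>)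
  then show ?thesis by (simp add: ae_eq_def)
qed

text \<open>Frees \<open>grad_norm\<close> from the choice inside \<open>grad\<close>: for sums,
  multiples, limits and test functions it is evaluated at the obvious weak gradient, one scalar
  \<open>L2\<close> component at a time.\<close>

lemma grad_norm_squared:
  assumes "u \<in> H1 \<Omega>" "weak_gradient \<Omega> u g"
  shows "(grad_norm \<Omega> u)\<^sup>2 = (\<Sum>i\<in>UNIV. L2_inner \<Omega> (\<lambda>x. g x $ i) (\<lambda>x. g x $ i))"
proof -
  note wg = weak_gradient_grad[OF assms(1)]
  have "(grad_norm \<Omega> u)\<^sup>2 = (\<integral>x. (norm (grad \<Omega> u x))\<^sup>2 \<partial>lebesgue_on \<Omega>)"
    by (simp add: grad_norm_def)
  also have "\<dots> = (\<integral>x. (\<Sum>i\<in>UNIV. grad \<Omega> u x $ i * grad \<Omega> u x $ i) \<partial>lebesgue_on \<Omega>)"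
    by (simp add: power2_norm_eq_inner inner_vec_def)
  also have "\<dots> = (\<Sum>i\<in>UNIV. L2_inner \<Omega> (\<lambda>x. grad \<Omega> u x $ i) (\<lambda>x. grad \<Omega> u x $ i))"
    unfolding L2_inner_def using weak_gradient_L2[OF wg]
    by (intro Bochner_Integration.integral_sum integrable_mult_L2)
  also have "\<dots> = (\<Sum>i\<in>UNIV. L2_inner \<Omega> (\<lambda>x. g x $ i) (\<lambda>x. g x $ i))"
    by (intro sum.cong refl L2_inner_ae_cong weak_gradient_unique[OF wg assms(2)]
        weak_gradient_L2[OF wg] weak_gradient_L2[OF assms(2)])
  finally show ?thesis .
qed

lemma H1_I: "u \<in> L2 \<Omega> \<Longrightarrow> weak_gradient \<Omega> u g \<Longrightarrow> u \<in> H1 \<Omega>"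
  by (auto simp: H1_def)

lemma H1_add: "u \<in> H1 \<Omega> \<Longrightarrow> v \<in> H1 \<Omega> \<Longrightarrow> (\<lambda>x. u x + v x) \<in> H1 \<Omega>"
  using H1_I[OF L2_add weak_gradient_add, OF H1_L2 H1_L2 H1_L2 H1_L2 weak_gradient_grad weak_gradient_grad] .

lemma H1_cmult: "u \<in> H1 \<Omega> \<Longrightarrow> (\<lambda>x. c * u x) \<in> H1 \<Omega>"
  using H1_I[OF L2_cmult weak_gradient_cmult, OF H1_L2 weak_gradient_grad] .

lemma H1_diff: "u \<in> H1 \<Omega> \<Longrightarrow> v \<in> H1 \<Omega> \<Longrightarrow> (\<lambda>x. u x - v x) \<in> H1 \<Omega>"
  using H1_add[of u "\<lambda>x. (-1) * v x"] H1_cmult[of v "-1"] by simp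

lemma weak_gradient_test_function:
  assumes "\<phi> \<in> test_functions \<Omega>"
  shows "weak_gradient \<Omega> \<phi> (\<lambda>x. \<chi> i. partial_deriv i \<phi> x)"
  unfolding weak_gradient_def
  using assms test_function_L2[OF domain_sets assms] integration_by_parts[OF domain_sets]
    test_function_differentiable[OF assms] test_function_partial_deriv_continuous[OF assms]
  by (auto simp: L2_inner_def)

lemma test_function_H1: "\<phi> \<in> test_functions \<Omega> \<Longrightarrow> \<phi> \<in> H1 \<Omega>"
  using H1_I weak_gradient_test_function test_function_L2(1)[OF domain_sets] by blast

lemma grad_norm_add_le:
  assumes "u \<in> H1 \<Omega>" "v \<in> H1 \<Omega>"
  shows "(grad_norm \<Omega> (\<lambda>x. u x + v x))\<^sup>2 \<le> 2 * (grad_norm \<Omega> u)\<^sup>2 + 2 * (grad_norm \<Omega> v)\<^sup>2"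
proof -
  note wu = weak_gradient_grad[OF assms(1)] and wv = weak_gradient_grad[OF assms(2)]
  have "(grad_norm \<Omega> (\<lambda>x. u x + v x))\<^sup>2
      = (\<Sum>i\<in>UNIV. L2_inner \<Omega> (\<lambda>x. grad \<Omega> u x $ i + grad \<Omega> v x $ i) (\<lambda>x. grad \<Omega> u x $ i + grad \<Omega> v x $ i))"
    using grad_norm_squared[OF H1_add[OF assms] weak_gradient_add[OF H1_L2 H1_L2 wu wv]] assms by simp
  also have "\<dots> \<le> (\<Sum>i\<in>UNIV. 2 * L2_inner \<Omega> (\<lambda>x. grad \<Omega> u x $ i) (\<lambda>x. grad \<Omega> u x $ i)
      + 2 * L2_inner \<Omega> (\<lambda>x. grad \<Omega> v x $ i) (\<lambda>x. grad \<Omega> v x $ i))"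
    by (intro sum_mono L2_inner_add_self_le weak_gradient_L2[OF wu] weak_gradient_L2[OF wv])
  also have "\<dots> = 2 * (grad_norm \<Omega> u)\<^sup>2 + 2 * (grad_norm \<Omega> v)\<^sup>2"
    by (simp add: grad_norm_squared[OF assms(1) wu] grad_norm_squared[OF assms(2) wv]
        sum.distrib sum_distrib_left)
  finally show ?thesis .
qed

lemma grad_norm_cmult:
  assumes "u \<in> H1 \<Omega>"
  shows "(grad_norm \<Omega> (\<lambda>x. c * u x))\<^sup>2 = c\<^sup>2 * (grad_norm \<Omega> u)\<^sup>2"
  using grad_norm_squared[OF H1_cmult[OF assms] weak_gradient_cmult[OF weak_gradient_grad[OF assms]], of c]
    grad_norm_squared[OF assms weak_gradient_grad[OF assms]]
  by (simp add: L2_inner_cmult_left L2_inner_cmult_right power2_eq_square sum_distrib_left mult.assoc)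

lemma H1_norm_add_le:
  assumes "u \<in> H1 \<Omega>" "v \<in> H1 \<Omega>"
  shows "(H1_norm \<Omega> (\<lambda>x. u x + v x))\<^sup>2 \<le> 2 * (H1_norm \<Omega> u)\<^sup>2 + 2 * (H1_norm \<Omega> v)\<^sup>2"
  unfolding H1_norm_squared
  using grad_norm_add_le[OF assms] L2_inner_add_self_le[OF H1_L2 H1_L2, OF assms] by argo

lemma H1_norm_cmult:
  assumes "u \<in> H1 \<Omega>"
  shows "(H1_norm \<Omega> (\<lambda>x. c * u x))\<^sup>2 = c\<^sup>2 * (H1_norm \<Omega> u)\<^sup>2"
  unfolding H1_norm_squared
  unfolding grad_norm_cmult[OF assms] by (simp add: L2_inner_cmult_left L2_inner_cmult_right power2_eq_square algebra_simps)

text \<open>The form with one approximant per tolerance spares diagonal sequences in the closure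
  proofs, and the squared norm fits \<open>H1_norm_add_le\<close>.\<close>

lemma H10_iff_approx:
  "u \<in> H10 \<Omega> \<longleftrightarrow> u \<in> H1 \<Omega> \<and> (\<forall>e>0. \<exists>\<phi>\<in>test_functions \<Omega>. (H1_norm \<Omega> (\<lambda>x. \<phi> x - u x))\<^sup>2 < e)"
proof (intro iffI conjI allI impI)
  fix e :: real assume u: "u \<in> H10 \<Omega>" and e: "e > 0"
  then obtain \<phi> where \<phi>: "\<And>n. \<phi> n \<in> test_functions \<Omega>" "(\<lambda>n. H1_norm \<Omega> (\<lambda>x. \<phi> n x - u x)) \<longlonglongrightarrow> 0"
    by (auto simp: H10_def)
  have "(\<lambda>n. (H1_norm \<Omega> (\<lambda>x. \<phi> n x - u x))\<^sup>2) \<longlonglongrightarrow> 0"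
    using tendsto_power[OF \<phi>(2), of 2] by simp
  then have "\<forall>\<^sub>F n in sequentially. (H1_norm \<Omega> (\<lambda>x. \<phi> n x - u x))\<^sup>2 < e"
    using e by (rule order_tendstoD)
  then obtain n where "(H1_norm \<Omega> (\<lambda>x. \<phi> n x - u x))\<^sup>2 < e"
    by (auto simp: eventually_sequentially)
  then show "\<exists>\<phi>\<in>test_functions \<Omega>. (H1_norm \<Omega> (\<lambda>x. \<phi> x - u x))\<^sup>2 < e"
    using \<phi>(1) by blast
next
  assume *: "u \<in> H1 \<Omega> \<and> (\<forall>e>0. \<exists>\<phi>\<in>test_functions \<Omega>. (H1_norm \<Omega> (\<lambda>x. \<phi> x - u x))\<^sup>2 < e)"
  then have "\<forall>n. \<exists>\<phi>\<in>test_functions \<Omega>. (H1_norm \<Omega> (\<lambda>x. \<phi> x - u x))\<^sup>2 < inverse (real (Suc n))"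
    by (intro allI) (auto simp del: of_nat_Suc)
  then obtain \<phi> where \<phi>: "\<And>n. \<phi> n \<in> test_functions \<Omega>"
    "\<And>n. (H1_norm \<Omega> (\<lambda>x. \<phi> n x - u x))\<^sup>2 < inverse (real (Suc n))"
    by metis
  have "(\<lambda>n. (H1_norm \<Omega> (\<lambda>x. \<phi> n x - u x))\<^sup>2) \<longlonglongrightarrow> 0"
    by (rule tendsto_sandwich[OF _ _ tendsto_const LIMSEQ_inverse_real_of_nat])
      (intro always_eventually allI zero_le_power2 less_imp_le[OF \<phi>(2)])+
  then have "(\<lambda>n. H1_norm \<Omega> (\<lambda>x. \<phi> n x - u x)) \<longlonglongrightarrow> 0" by simp
  then show "u \<in> H10 \<Omega>" using * \<phi>(1) by (auto simp: H10_def)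
qed (simp add: H10_H1)

lemma H10_approx:
  assumes "u \<in> H10 \<Omega>" "e > 0"
  obtains \<phi> where "\<phi> \<in> test_functions \<Omega>" "(H1_norm \<Omega> (\<lambda>x. \<phi> x - u x))\<^sup>2 < e"
  using assms H10_iff_approx by blast

section \<open>Linear structure of \<open>H10\<close>\<close>

lemma H10_add:
  assumes "u \<in> H10 \<Omega>" "v \<in> H10 \<Omega>"
  shows "(\<lambda>x. u x + v x) \<in> H10 \<Omega>"
  unfolding H10_iff_approx
proof (intro conjI allI impI)
  show "(\<lambda>x. u x + v x) \<in> H1 \<Omega>" using assms by (intro H1_add H10_H1)
  fix e :: real assume "e > 0"
  \<comment> \<open>Each of the two squared errors is doubled by
    \<open>H1_norm_add_le\<close>.\<close>
  then have "e / 4 > 0" by simp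
  obtain f where f: "f \<in> test_functions \<Omega>" "(H1_norm \<Omega> (\<lambda>x. f x - u x))\<^sup>2 < e / 4"
    using assms(1) \<open>e / 4 > 0\<close> by (rule H10_approx)
  obtain g where g: "g \<in> test_functions \<Omega>" "(H1_norm \<Omega> (\<lambda>x. g x - v x))\<^sup>2 < e / 4"
    using assms(2) \<open>e / 4 > 0\<close> by (rule H10_approx)
  have "(\<lambda>x. f x - u x) \<in> H1 \<Omega>" "(\<lambda>x. g x - v x) \<in> H1 \<Omega>"
    using f g assms by (simp_all add: H1_diff test_function_H1 H10_H1)
  from H1_norm_add_le[OF this] have "(H1_norm \<Omega> (\<lambda>x. (f x - u x) + (g x - v x)))\<^sup>2 < e"
    using f(2) g(2) by argo
  then have "(H1_norm \<Omega> (\<lambda>x. (f x + g x) - (u x + v x)))\<^sup>2 < e"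
    by (simp add: algebra_simps)
  then show "\<exists>\<phi>\<in>test_functions \<Omega>. (H1_norm \<Omega> (\<lambda>x. \<phi> x - (u x + v x)))\<^sup>2 < e"
    by (intro bexI[OF _ test_functions_add[OF f(1) g(1)]])
qed

lemma H10_cmult:
  assumes "u \<in> H10 \<Omega>"
  shows "(\<lambda>x. c * u x) \<in> H10 \<Omega>"
  unfolding H10_iff_approx
proof (intro conjI allI impI)
  show "(\<lambda>x. c * u x) \<in> H1 \<Omega>" using assms by (intro H1_cmult H10_H1)
  fix e :: real assume "e > 0"
  \<comment> \<open>The added 1 covers \<open>c = 0\<close> without a case distinction.\<close>
  then have pos: "e / (c\<^sup>2 + 1) > 0" by (simp add: add_nonneg_pos)
  obtain f where f: "f \<in> test_functions \<Omega>" "(H1_norm \<Omega> (\<lambda>x. f x - u x))\<^sup>2 < e / (c\<^sup>2 + 1)"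
    using assms pos by (rule H10_approx)
  have "(H1_norm \<Omega> (\<lambda>x. c * (f x - u x)))\<^sup>2 = c\<^sup>2 * (H1_norm \<Omega> (\<lambda>x. f x - u x))\<^sup>2"
    using f assms by (simp add: H1_norm_cmult H1_diff test_function_H1 H10_H1)
  also have "\<dots> \<le> c\<^sup>2 * (e / (c\<^sup>2 + 1))" using f by (intro mult_left_mono) auto
  also have "\<dots> < (c\<^sup>2 + 1) * (e / (c\<^sup>2 + 1))"
    using pos by (intro mult_strict_right_mono) auto
  also have "\<dots> = e" by (simp add: add_nonneg_eq_0_iff)
  finally have "(H1_norm \<Omega> (\<lambda>x. c * f x - c * u x))\<^sup>2 < e"
    by (simp add: algebra_simps)
  then show "\<exists>\<phi>\<in>test_functions \<Omega>. (H1_norm \<Omega> (\<lambda>x. \<phi> x - c * u x))\<^sup>2 < e"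
    by (intro bexI[OF _ test_functions_cmult[OF f(1)]])
qed

lemma H10_diff: "u \<in> H10 \<Omega> \<Longrightarrow> v \<in> H10 \<Omega> \<Longrightarrow> (\<lambda>x. u x - v x) \<in> H10 \<Omega>"
  using H10_add[of u "\<lambda>x. (-1) * v x"] H10_cmult[of v "-1"] by simp

lemma H10_zero: "(\<lambda>x. 0) \<in> H10 \<Omega>"
  unfolding H10_iff_approx
proof (intro conjI allI impI)
  have test: "(\<lambda>x. 0) \<in> test_functions \<Omega>"
    by (auto simp: test_functions_def intro: bump_algebra_imp_Ck bump_algebra.const)
  show "(\<lambda>x. 0) \<in> H1 \<Omega>" by (rule test_function_H1[OF test])
  fix e :: real assume "e > 0"
  \<comment> \<open>The chosen gradient of the zero function is 0 only almost everywhere, so its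
    norm is read off from homogeneity with factor 0.\<close>
  have "(H1_norm \<Omega> (\<lambda>x. 0 * (0::real)))\<^sup>2 = 0\<^sup>2 * (H1_norm \<Omega> (\<lambda>x. 0))\<^sup>2"
    by (rule H1_norm_cmult[OF test_function_H1[OF test]])
  then show "\<exists>\<phi>\<in>test_functions \<Omega>. (H1_norm \<Omega> (\<lambda>x. \<phi> x - 0))\<^sup>2 < e"
    using \<open>e > 0\<close> by (intro bexI[OF _ test]) simp
qed

lemma H10_sum: "finite I \<Longrightarrow> (\<And>i. i \<in> I \<Longrightarrow> u i \<in> H10 \<Omega>) \<Longrightarrow> (\<lambda>x. \<Sum>i\<in>I. u i x) \<in> H10 \<Omega>"
  by (induction I rule: finite_induct) (auto intro: H10_zero H10_add)

text \<open>Density of test functions extends their inequality. The constant grows by 4 because a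
  square of a sum is split with a factor 2 once for the function and once for its gradient.\<close>

lemma Poincare_H10:
  obtains C where "C > 0" "\<And>u. u \<in> H10 \<Omega> \<Longrightarrow> L2_inner \<Omega> u u \<le> C * (grad_norm \<Omega> u)\<^sup>2"
proof -
  \<comment> \<open>Any coordinate direction serves; the dimension is at least 1 since types are
    inhabited.\<close>
  fix i :: 'd
  obtain R where R: "\<And>x. x \<in> \<Omega> \<Longrightarrow> norm x \<le> R" and "R > 0"
    using domain by (auto simp: bounded_domain_def bounded_pos)
  define C where "C = 4 * R\<^sup>2"
  have "C > 0" using \<open>R > 0\<close> by (simp add: C_def)
  have test: "L2_inner \<Omega> \<phi> \<phi> \<le> C * (grad_norm \<Omega> \<phi>)\<^sup>2" if \<phi>: "\<phi> \<in> test_functions \<Omega>" for \<phi>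
  proof -
    have "L2_inner \<Omega> \<phi> \<phi> \<le> C * L2_inner \<Omega> (partial_deriv i \<phi>) (partial_deriv i \<phi>)"
      unfolding C_def using domain_sets _ \<phi>
      by (rule Poincare_test_function) (meson R component_le_norm_cart order_trans)
    also have "L2_inner \<Omega> (partial_deriv i \<phi>) (partial_deriv i \<phi>)
        \<le> (\<Sum>i\<in>UNIV. L2_inner \<Omega> (partial_deriv i \<phi>) (partial_deriv i \<phi>))"
      by (rule member_le_sum) (auto simp: L2_inner_self_nonneg)
    also have "\<dots> = (grad_norm \<Omega> \<phi>)\<^sup>2"
      using grad_norm_squared[OF test_function_H1[OF \<phi>] weak_gradient_test_function[OF \<phi>]] by simp
    finally show ?thesis using \<open>C > 0\<close> by simp
  qed
  show thesis
  proof
    show "4 * C > 0" using \<open>C > 0\<close> by simp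
    fix u assume u: "u \<in> H10 \<Omega>"
    show "L2_inner \<Omega> u u \<le> 4 * C * (grad_norm \<Omega> u)\<^sup>2"
    proof (rule field_le_epsilon)
      fix e :: real assume "e > 0"
      \<comment> \<open>The approximation error will enter with weight \<open>4 * C\<close> on its
        gradient and weight 2 on its \<open>L2\<close> part, both at most
        \<open>2 + 4 * C\<close>.\<close>
      then have pos: "e / (2 + 4 * C) > 0" using \<open>C > 0\<close> by simp
      obtain \<phi> where \<phi>: "\<phi> \<in> test_functions \<Omega>" "(H1_norm \<Omega> (\<lambda>x. \<phi> x - u x))\<^sup>2 < e / (2 + 4 * C)"
        using u pos by (rule H10_approx)
      define d where "d x = \<phi> x - u x" for x
      have H1s: "u \<in> H1 \<Omega>" "\<phi> \<in> H1 \<Omega>" "d \<in> H1 \<Omega>"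
        unfolding d_def using u \<phi> by (simp_all add: H1_diff test_function_H1 H10_H1)
      have d: "L2_inner \<Omega> d d + (grad_norm \<Omega> d)\<^sup>2 \<le> e / (2 + 4 * C)"
        using \<phi>(2) by (simp add: H1_norm_squared flip: d_def)
      have d_sq: "L2_inner \<Omega> d d \<ge> 0" "(grad_norm \<Omega> d)\<^sup>2 \<ge> 0"
        by (auto simp: L2_inner_self_nonneg)
      have "(\<lambda>x. \<phi> x + (-1) * d x) = u" by (simp add: d_def)
      then have "L2_inner \<Omega> u u \<le> 2 * L2_inner \<Omega> \<phi> \<phi> + 2 * L2_inner \<Omega> d d"
        using L2_inner_add_self_le[OF H1_L2[OF H1s(2)] L2_cmult[OF H1_L2[OF H1s(3)], of "-1"]]
        unfolding L2_inner_cmult_left L2_inner_cmult_right by simp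
      also have "\<dots> \<le> 2 * (C * (grad_norm \<Omega> \<phi>)\<^sup>2) + 2 * L2_inner \<Omega> d d"
        using test[OF \<phi>(1)] by simp
      also have "(grad_norm \<Omega> \<phi>)\<^sup>2 \<le> 2 * (grad_norm \<Omega> u)\<^sup>2 + 2 * (grad_norm \<Omega> d)\<^sup>2"
        using grad_norm_add_le[OF H1s(1,3)] by (simp add: d_def)
      finally have "L2_inner \<Omega> u u \<le> 4 * C * (grad_norm \<Omega> u)\<^sup>2 + (4 * C * (grad_norm \<Omega> d)\<^sup>2 + 2 * L2_inner \<Omega> d d)"
        using \<open>C > 0\<close> by (simp add: algebra_simps)
      also have "4 * C * (grad_norm \<Omega> d)\<^sup>2 + 2 * L2_inner \<Omega> d d
          \<le> (2 + 4 * C) * (L2_inner \<Omega> d d + (grad_norm \<Omega> d)\<^sup>2)"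
        using \<open>C > 0\<close> d_sq by (simp add: algebra_simps)
      also have "\<dots> \<le> (2 + 4 * C) * (e / (2 + 4 * C))"
        using d \<open>C > 0\<close> by (intro mult_left_mono) auto
      also have "\<dots> = e" using \<open>C > 0\<close> by simp
      finally show "L2_inner \<Omega> u u \<le> 4 * C * (grad_norm \<Omega> u)\<^sup>2 + e" by simp
    qed
  qed
qed

text \<open>By the Poincare inequality the functions are Cauchy in \<open>L2\<close> as well as
  their gradient components. The defining identity of weak gradients pairs with fixed test functions
  and hence survives the limit; approximants of a late \<open>u n\<close> then approximate the
  limit.\<close>

lemma H10_complete:
  assumes u: "\<And>n. u n \<in> H10 \<Omega>"
    and Cauchy: "\<And>e. e > 0 \<Longrightarrow> \<exists>N. \<forall>m\<ge>N. \<forall>n\<ge>N. (grad_norm \<Omega> (\<lambda>x. u m x - u n x))\<^sup>2 \<le> e"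
  obtains u' where "u' \<in> H10 \<Omega>" "(\<lambda>n. (grad_norm \<Omega> (\<lambda>x. u n x - u' x))\<^sup>2) \<longlonglongrightarrow> 0"
proof -
  note uL2 = H10_L2[OF u] and uH1 = H10_H1[OF u]
  note wg = weak_gradient_grad[OF uH1]
  have wg_diff: "weak_gradient \<Omega> (\<lambda>x. v x - w x) (\<lambda>x. g x - h x)"
    if "v \<in> L2 \<Omega>" "w \<in> L2 \<Omega>" "weak_gradient \<Omega> v g" "weak_gradient \<Omega> w h" for v w g h
    using weak_gradient_add[OF that(1) L2_cmult[OF that(2), of "-1"] that(3)
        weak_gradient_cmult[OF that(4), of "-1"]] by simp
  obtain C where "C > 0" and C: "\<And>u. u \<in> H10 \<Omega> \<Longrightarrow> L2_inner \<Omega> u u \<le> C * (grad_norm \<Omega> u)\<^sup>2"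
    using Poincare_H10 by blast
  obtain u' where u': "u' \<in> L2 \<Omega>"
    "(\<lambda>n. L2_inner \<Omega> (\<lambda>x. u n x - u' x) (\<lambda>x. u n x - u' x)) \<longlonglongrightarrow> 0"
  proof (rule L2_complete[OF uL2])
    fix e :: real assume "e > 0"
    then obtain N where N: "\<forall>m\<ge>N. \<forall>n\<ge>N. (grad_norm \<Omega> (\<lambda>x. u m x - u n x))\<^sup>2 \<le> e / C"
      using Cauchy[of "e / C"] \<open>C > 0\<close> by auto
    have "L2_inner \<Omega> (\<lambda>x. u m x - u n x) (\<lambda>x. u m x - u n x) \<le> e" if "m \<ge> N" "n \<ge> N" for m n
    proof -
      have "L2_inner \<Omega> (\<lambda>x. u m x - u n x) (\<lambda>x. u m x - u n x) \<le> C * (grad_norm \<Omega> (\<lambda>x. u m x - u n x))\<^sup>2"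
        by (intro C H10_diff u)
      also have "\<dots> \<le> C * (e / C)" using N that \<open>C > 0\<close> by (intro mult_left_mono) auto
      finally show ?thesis using \<open>C > 0\<close> by simp
    qed
    then show "\<exists>N. \<forall>m\<ge>N. \<forall>n\<ge>N. L2_inner \<Omega> (\<lambda>x. u m x - u n x) (\<lambda>x. u m x - u n x) \<le> e" by blast
  qed
  have "\<exists>G. G \<in> L2 \<Omega> \<and> (\<lambda>n. L2_inner \<Omega> (\<lambda>x. grad \<Omega> (u n) x $ i - G x) (\<lambda>x. grad \<Omega> (u n) x $ i - G x)) \<longlonglongrightarrow> 0" for i
  proof (rule L2_complete[of "\<lambda>n x. grad \<Omega> (u n) x $ i" \<Omega>])
    show "(\<lambda>x. grad \<Omega> (u n) x $ i) \<in> L2 \<Omega>" for n by (rule weak_gradient_L2[OF wg])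
    fix e :: real assume "e > 0"
    then obtain N where N: "\<forall>m\<ge>N. \<forall>n\<ge>N. (grad_norm \<Omega> (\<lambda>x. u m x - u n x))\<^sup>2 \<le> e"
      using Cauchy by blast
    have "L2_inner \<Omega> (\<lambda>x. grad \<Omega> (u m) x $ i - grad \<Omega> (u n) x $ i) (\<lambda>x. grad \<Omega> (u m) x $ i - grad \<Omega> (u n) x $ i)
        \<le> (grad_norm \<Omega> (\<lambda>x. u m x - u n x))\<^sup>2" for m n
      using grad_norm_squared[OF H1_diff[OF uH1 uH1] wg_diff[OF uL2 uL2 wg wg], of m n]
        member_le_sum[of i UNIV "\<lambda>i. L2_inner \<Omega> (\<lambda>x. grad \<Omega> (u m) x $ i - grad \<Omega> (u n) x $ i)
          (\<lambda>x. grad \<Omega> (u m) x $ i - grad \<Omega> (u n) x $ i)"]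
      by (simp add: L2_inner_self_nonneg)
    then show "\<exists>N. \<forall>m\<ge>N. \<forall>n\<ge>N. L2_inner \<Omega> (\<lambda>x. grad \<Omega> (u m) x $ i - grad \<Omega> (u n) x $ i)
        (\<lambda>x. grad \<Omega> (u m) x $ i - grad \<Omega> (u n) x $ i) \<le> e"
      using N by (meson order_trans)
  qed blast
  from choice[OF allI, OF this] obtain G where G0: "\<forall>i. G i \<in> L2 \<Omega> \<and>
    (\<lambda>n. L2_inner \<Omega> (\<lambda>x. grad \<Omega> (u n) x $ i - G i x) (\<lambda>x. grad \<Omega> (u n) x $ i - G i x)) \<longlonglongrightarrow> 0"
    by (rule exE)
  note G = G0[rule_format, THEN conjunct1] G0[rule_format, THEN conjunct2]
  have wg': "weak_gradient \<Omega> u' (\<lambda>x. \<chi> i. G i x)"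
    unfolding weak_gradient_def
  proof (intro conjI allI ballI)
    fix \<phi> i assume \<phi>: "\<phi> \<in> test_functions \<Omega>"
    note \<phi>_L2 = test_function_L2[OF domain_sets \<phi>]
    have "(\<lambda>n. L2_inner \<Omega> (u n) (partial_deriv i \<phi>)) \<longlonglongrightarrow> L2_inner \<Omega> u' (partial_deriv i \<phi>)"
      by (intro L2_inner_tendsto uL2 u' \<phi>_L2)
    moreover have "L2_inner \<Omega> (u n) (partial_deriv i \<phi>) = - L2_inner \<Omega> (\<lambda>x. grad \<Omega> (u n) x $ i) \<phi>" for n
      using wg[of n] \<phi> by (auto simp: weak_gradient_def)
    moreover have "(\<lambda>n. - L2_inner \<Omega> (\<lambda>x. grad \<Omega> (u n) x $ i) \<phi>) \<longlonglongrightarrow> - L2_inner \<Omega> (G i) \<phi>"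
      by (intro tendsto_minus L2_inner_tendsto weak_gradient_L2[OF wg] G \<phi>_L2)
    ultimately show "L2_inner \<Omega> u' (partial_deriv i \<phi>) = - L2_inner \<Omega> (\<lambda>x. (\<chi> i. G i x) $ i) \<phi>"
      by (auto intro: LIMSEQ_unique)
  qed (simp add: G)
  have u'H1: "u' \<in> H1 \<Omega>" by (rule H1_I[OF u'(1) wg'])
  have grad_lim: "(\<lambda>n. (grad_norm \<Omega> (\<lambda>x. u n x - u' x))\<^sup>2) \<longlonglongrightarrow> 0"
  proof -
    have "(grad_norm \<Omega> (\<lambda>x. u n x - u' x))\<^sup>2
        = (\<Sum>i\<in>UNIV. L2_inner \<Omega> (\<lambda>x. grad \<Omega> (u n) x $ i - G i x) (\<lambda>x. grad \<Omega> (u n) x $ i - G i x))" for n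
      using grad_norm_squared[OF H1_diff[OF uH1 u'H1] wg_diff[OF uL2 u'(1) wg wg'], of n] by simp
    moreover have "(\<lambda>n. \<Sum>i\<in>UNIV. L2_inner \<Omega> (\<lambda>x. grad \<Omega> (u n) x $ i - G i x) (\<lambda>x. grad \<Omega> (u n) x $ i - G i x))
        \<longlonglongrightarrow> (\<Sum>i\<in>(UNIV :: 'd set). 0)"
      by (intro tendsto_sum G)
    ultimately show ?thesis by simp
  qed
  have H1_lim: "(\<lambda>n. (H1_norm \<Omega> (\<lambda>x. u n x - u' x))\<^sup>2) \<longlonglongrightarrow> 0"
    using tendsto_add[OF u'(2) grad_lim] by (simp add: H1_norm_squared)
  have "u' \<in> H10 \<Omega>"
    unfolding H10_iff_approx
  proof (intro conjI allI impI u'H1)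
    fix e :: real assume "e > 0"
    then have "\<forall>\<^sub>F n in sequentially. (H1_norm \<Omega> (\<lambda>x. u n x - u' x))\<^sup>2 < e / 4"
      by (intro order_tendstoD[OF H1_lim]) simp
    then obtain n where n: "(H1_norm \<Omega> (\<lambda>x. u n x - u' x))\<^sup>2 < e / 4"
      by (auto simp: eventually_sequentially)
    obtain \<phi> where \<phi>: "\<phi> \<in> test_functions \<Omega>" "(H1_norm \<Omega> (\<lambda>x. \<phi> x - u n x))\<^sup>2 < e / 4"
      by (rule H10_approx[OF u, of "e / 4" n]) (use \<open>e > 0\<close> in auto)
    have "(H1_norm \<Omega> (\<lambda>x. (\<phi> x - u n x) + (u n x - u' x)))\<^sup>2 < e"
      using H1_norm_add_le[OF H1_diff[OF test_function_H1[OF \<phi>(1)] uH1] H1_diff[OF uH1 u'H1], of n n] n \<phi>(2)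
      by argo
    then show "\<exists>\<phi>\<in>test_functions \<Omega>. (H1_norm \<Omega> (\<lambda>x. \<phi> x - u' x))\<^sup>2 < e"
      using \<phi>(1) by auto
  qed
  then show thesis using grad_lim by (rule that)
qed

end

subsection \<open>The Riesz representation theorem on \<open>H10\<close>\<close>

text \<open>
  A minimising sequence of \<open>J v = B v v - 2 * f v\<close> is Cauchy by the parallelogram identity, and
  the limit satisfies the Euler equation \<open>B u v = f v\<close>.
\<close>

lemma H10_Riesz:
  fixes \<Omega> :: "(real ^ 'd::finite) set"
  assumes domain: "bounded_domain \<Omega>" and B: "inner_product_on_H10 \<Omega> B"
    and "c > 0" and lower: "\<And>u. u \<in> H10 \<Omega> \<Longrightarrow> c * (grad_norm \<Omega> u)\<^sup>2 \<le> B u u"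
    and upper: "\<And>u. u \<in> H10 \<Omega> \<Longrightarrow> B u u \<le> c' * (grad_norm \<Omega> u)\<^sup>2"
    and f_add: "\<And>u v. u \<in> H10 \<Omega> \<Longrightarrow> v \<in> H10 \<Omega> \<Longrightarrow> f (\<lambda>x. u x + v x) = f u + f v"
    and f_cmult: "\<And>a u. u \<in> H10 \<Omega> \<Longrightarrow> f (\<lambda>x. a * u x) = a * f u"
    and "C \<ge> 0" and f_bound: "\<And>u. u \<in> H10 \<Omega> \<Longrightarrow> (f u)\<^sup>2 \<le> C * B u u"
  obtains u where "u \<in> H10 \<Omega>" "\<And>v. v \<in> H10 \<Omega> \<Longrightarrow> B u v = f v"
proof -
  note H10_add = H10_add[OF domain] and H10_cmult = H10_cmult[OF domain] and H10_diff = H10_diff[OF domain]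
  have B_sym: "B u v = B v u" if "u \<in> H10 \<Omega>" "v \<in> H10 \<Omega>" for u v
    using B that by (simp add: inner_product_on_H10_def)
  have B_add: "B (\<lambda>x. u x + v x) w = B u w + B v w" if "u \<in> H10 \<Omega>" "v \<in> H10 \<Omega>" "w \<in> H10 \<Omega>" for u v w
    using B that by (simp add: inner_product_on_H10_def)
  have B_cmult: "B (\<lambda>x. a * u x) v = a * B u v" if "u \<in> H10 \<Omega>" "v \<in> H10 \<Omega>" for a u v
    using B that unfolding inner_product_on_H10_def by blast
  have B_nonneg: "0 \<le> B u u" if "u \<in> H10 \<Omega>" for u
    using B that by (simp add: inner_product_on_H10_def)
  have B_diff: "B (\<lambda>x. u x - v x) w = B u w - B v w" if "u \<in> H10 \<Omega>" "v \<in> H10 \<Omega>" "w \<in> H10 \<Omega>" for u v w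
    using B_add[OF that(1) H10_cmult[OF that(2), of "-1"] that(3)] B_cmult[OF that(2,3), of "-1"] by simp
  have B_expand: "B (\<lambda>x. u x + t * v x) (\<lambda>x. u x + t * v x) = B u u + 2 * t * B u v + t\<^sup>2 * B v v"
    if "u \<in> H10 \<Omega>" "v \<in> H10 \<Omega>" for u v t
  proof -
    note tv = H10_cmult[OF that(2), of t] and utv = H10_add[OF that(1) H10_cmult[OF that(2), of t]]
    have "B (\<lambda>x. u x + t * v x) (\<lambda>x. u x + t * v x) = B (\<lambda>x. u x + t * v x) u + t * B (\<lambda>x. u x + t * v x) v"
      using B_add[OF that(1) tv utv] B_cmult[OF that(2) utv] B_sym[OF that(1) utv] B_sym[OF that(2) utv] by simp
    also have "\<dots> = B u u + t * B v u + t * (B u v + t * B v v)"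
      using B_add[OF that(1) tv] B_cmult[OF that(2)] that by simp
    finally show ?thesis using B_sym[OF that] by (simp add: algebra_simps power2_eq_square)
  qed
  define J where "J v = B v v - 2 * f v" for v
  have J_expand: "J (\<lambda>x. u x + t * v x) = J u + 2 * t * (B u v - f v) + t\<^sup>2 * B v v"
    if "u \<in> H10 \<Omega>" "v \<in> H10 \<Omega>" for u v t
    using B_expand[OF that, of t] f_add[OF that(1) H10_cmult[OF that(2), of t]] f_cmult[OF that(2), of t]
    by (simp add: J_def algebra_simps)
  have J_ge: "J v \<ge> - C" if "v \<in> H10 \<Omega>" for v
  proof -
    \<comment> \<open>The inequality of arithmetic and geometric means, so that the linear term
      \<open>2 * f v\<close> costs at most \<open>C + B v v\<close>.\<close>
    have "(f v)\<^sup>2 \<le> ((C + B v v) / 2)\<^sup>2"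
      using f_bound[OF that] sum_squares_bound[of C "B v v"]
      by (simp add: power2_eq_square field_simps)
    then have "\<bar>f v\<bar> \<le> \<bar>(C + B v v) / 2\<bar>" by (simp only: abs_le_square_iff)
    then show ?thesis using \<open>C \<ge> 0\<close> B_nonneg[OF that] by (simp add: J_def)
  qed
  define m where "m = Inf (J ` H10 \<Omega>)"
  have ne: "J ` H10 \<Omega> \<noteq> {}" using H10_zero[OF domain] by blast
  have m_le: "m \<le> J v" if "v \<in> H10 \<Omega>" for v
    unfolding m_def using that J_ge by (intro cInf_lower) (auto intro!: bdd_belowI)
  have "\<exists>v\<in>H10 \<Omega>. J v < m + inverse (real (Suc n))" for n
    using cInf_lessD[OF ne, of "m + inverse (real (Suc n))"] by (auto simp: m_def simp del: of_nat_Suc)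
  then obtain v where v: "\<And>n. v n \<in> H10 \<Omega>" "\<And>n. J (v n) < m + inverse (real (Suc n))"
    by metis
  have J_lim: "(\<lambda>n. J (v n) - m) \<longlonglongrightarrow> 0"
  proof (rule tendsto_sandwich[OF _ _ tendsto_const LIMSEQ_inverse_real_of_nat])
    show "\<forall>\<^sub>F n in sequentially. 0 \<le> J (v n) - m"
      using m_le[OF v(1)] by (intro always_eventually) simp
    show "\<forall>\<^sub>F n in sequentially. J (v n) - m \<le> inverse (real (Suc n))"
      using v(2) by (intro always_eventually allI) (metis add.commute diff_le_eq less_imp_le)
  qed
  have parallelogram: "B (\<lambda>x. u x - w x) (\<lambda>x. u x - w x) \<le> 2 * (J u - m) + 2 * (J w - m)"
    if "u \<in> H10 \<Omega>" "w \<in> H10 \<Omega>" for u w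
  proof -
    define d where "d x = u x - w x" for x
    have d: "d \<in> H10 \<Omega>" unfolding d_def by (rule H10_diff[OF that])
    have "J u = J w + 2 * (B w d - f d) + B d d"
      using J_expand[OF that(2) d, of 1] by (simp add: d_def)
    \<comment> \<open>The midpoint of \<open>u\<close> and \<open>w\<close>, at which
      \<open>J\<close> is at least \<open>m\<close>.\<close>
    moreover have "J (\<lambda>x. w x + 1/2 * d x) = J w + (B w d - f d) + B d d / 4"
      using J_expand[OF that(2) d, of "1/2"] by (simp add: power2_eq_square)
    moreover have "m \<le> J (\<lambda>x. w x + 1/2 * d x)"
      by (intro m_le H10_add H10_cmult that d)
    ultimately have "B d d \<le> 2 * (J u - m) + 2 * (J w - m)" by argo
    then show ?thesis by (simp add: d_def[abs_def])
  qed
  obtain u where u: "u \<in> H10 \<Omega>" "(\<lambda>n. (grad_norm \<Omega> (\<lambda>x. v n x - u x))\<^sup>2) \<longlonglongrightarrow> 0"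
  proof (rule H10_complete[OF domain v(1)])
    fix e :: real assume "e > 0"
    then have "\<forall>\<^sub>F n in sequentially. J (v n) - m < c * e / 4"
      using \<open>c > 0\<close> by (intro order_tendstoD[OF J_lim]) simp
    then obtain N where N: "\<And>n. n \<ge> N \<Longrightarrow> J (v n) - m < c * e / 4"
      by (auto simp: eventually_sequentially)
    have "(grad_norm \<Omega> (\<lambda>x. v i x - v j x))\<^sup>2 \<le> e" if "i \<ge> N" "j \<ge> N" for i j
    proof -
      have "c * (grad_norm \<Omega> (\<lambda>x. v i x - v j x))\<^sup>2 \<le> c * e"
        using lower[OF H10_diff[OF v(1) v(1)], of i j] parallelogram[OF v(1) v(1), of i j] N[OF that(1)] N[OF that(2)]
        by argo
      then show ?thesis using \<open>c > 0\<close> by simp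
    qed
    then show "\<exists>N. \<forall>i\<ge>N. \<forall>j\<ge>N. (grad_norm \<Omega> (\<lambda>x. v i x - v j x))\<^sup>2 \<le> e" by blast
  qed
  \<comment> \<open>The upper bound on \<open>B\<close> is what turns convergence of gradients into
    convergence in energy.\<close>
  have B_lim: "(\<lambda>n. B (\<lambda>x. v n x - u x) (\<lambda>x. v n x - u x)) \<longlonglongrightarrow> 0"
  proof (rule tendsto_sandwich[OF _ _ tendsto_const])
    show "(\<lambda>n. c' * (grad_norm \<Omega> (\<lambda>x. v n x - u x))\<^sup>2) \<longlonglongrightarrow> 0"
      using tendsto_mult_left[OF u(2), of c'] by simp
  qed (intro always_eventually allI B_nonneg upper H10_diff v(1) u(1))+
  have "B u w = f w" if w: "w \<in> H10 \<Omega>" for w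
  proof -
    have square_lim: "a \<longlonglongrightarrow> 0" if "\<And>n. (a n)\<^sup>2 \<le> b n * B w w" "b \<longlonglongrightarrow> 0" for a b :: "nat \<Rightarrow> real"
    proof -
      have "(\<lambda>n. (a n)\<^sup>2) \<longlonglongrightarrow> 0"
        by (rule tendsto_sandwich[OF _ _ tendsto_const, where h = "\<lambda>n. b n * B w w"])
          (use that tendsto_mult_right[OF that(2), of "B w w"] in \<open>auto intro!: always_eventually\<close>)
      then show ?thesis by simp
    qed
    \<comment> \<open>A quantitative Euler equation: \<open>J - m\<close> along the line through
      \<open>v n\<close> in direction \<open>w\<close> is a nonnegative quadratic, and its
      discriminant bounds the defect of \<open>v n\<close> by its distance from the infimum. The
      limit of the defects then replaces an argument that \<open>u\<close> minimises
      \<open>J\<close>.\<close>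
    have "(\<lambda>n. B (v n) w - f w) \<longlonglongrightarrow> 0"
    proof (rule square_lim[OF _ J_lim])
      show "(B (v n) w - f w)\<^sup>2 \<le> (J (v n) - m) * B w w" for n
      proof (rule discriminant_nonpos)
        fix t
        have "m \<le> J (\<lambda>x. v n x + t * w x)" by (intro m_le H10_add H10_cmult v(1) w)
        then show "0 \<le> J (v n) - m + 2 * t * (B (v n) w - f w) + t\<^sup>2 * B w w"
          using J_expand[OF v(1) w, of n t] by simp
      qed (rule B_nonneg[OF w])
    qed
    moreover have "(\<lambda>n. B (\<lambda>x. v n x - u x) w) \<longlonglongrightarrow> 0"
    proof (rule square_lim[OF _ B_lim])
      show "(B (\<lambda>x. v n x - u x) w)\<^sup>2 \<le> B (\<lambda>x. v n x - u x) (\<lambda>x. v n x - u x) * B w w" for n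
      proof (rule discriminant_nonpos)
        note d = H10_diff[OF v(1)[of n] u(1)]
        fix t show "0 \<le> B (\<lambda>x. v n x - u x) (\<lambda>x. v n x - u x) + 2 * t * B (\<lambda>x. v n x - u x) w + t\<^sup>2 * B w w"
          using B_nonneg[OF H10_add[OF d H10_cmult[OF w, of t]]] B_expand[OF d w, of t] by simp
      qed (rule B_nonneg[OF w])
    qed
    ultimately have "(\<lambda>n. (B (v n) w - f w) - B (\<lambda>x. v n x - u x) w) \<longlonglongrightarrow> 0"
      using tendsto_diff by fastforce
    then have "(\<lambda>n. B u w - f w) \<longlonglongrightarrow> 0"
      using B_diff[OF v(1) u(1) w] by simp
    then show ?thesis by (simp add: LIMSEQ_const_iff)
  qed
  with u(1) show thesis by (rule that)
qed

text \<open>Existence of one solution pins the chosen value to \<open>H10 \<Omega>\<close>.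
  Cauchy-Schwarz, the Poincare constant \<open>C\<close> and coercivity with constant
  \<open>c\<close> bound the functional, which explains the factor \<open>C / c\<close>.\<close>

lemma solution_op_H10:
  assumes domain: "bounded_domain \<Omega>" and B: "inner_product_on_H10 \<Omega> (energy_form \<Omega> \<V>)"
    and "c > 0" and lower: "\<And>u. u \<in> H10 \<Omega> \<Longrightarrow> c * (grad_norm \<Omega> u)\<^sup>2 \<le> energy_form \<Omega> \<V> u u"
    and upper: "\<And>u. u \<in> H10 \<Omega> \<Longrightarrow> energy_form \<Omega> \<V> u u \<le> c' * (grad_norm \<Omega> u)\<^sup>2"
    and w: "w \<in> L2 \<Omega>"
  shows "solution_op \<Omega> \<V> (L2_inner \<Omega> w) \<in> H10 \<Omega>"
proof -
  obtain C where "C > 0" and C: "\<And>u. u \<in> H10 \<Omega> \<Longrightarrow> L2_inner \<Omega> u u \<le> C * (grad_norm \<Omega> u)\<^sup>2"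
    using Poincare_H10[OF domain] by blast
  obtain u where "u \<in> H10 \<Omega>" "\<And>v. v \<in> H10 \<Omega> \<Longrightarrow> energy_form \<Omega> \<V> u v = L2_inner \<Omega> w v"
  proof (rule H10_Riesz[OF domain B \<open>c > 0\<close> lower upper])
    show "0 \<le> L2_inner \<Omega> w w * (C / c)"
      using \<open>c > 0\<close> \<open>C > 0\<close> by (simp add: L2_inner_self_nonneg)
    fix v assume v: "v \<in> H10 \<Omega>"
    have "L2_inner \<Omega> v v \<le> C / c * (c * (grad_norm \<Omega> v)\<^sup>2)"
      using C[OF v] \<open>c > 0\<close> by simp
    also have "\<dots> \<le> C / c * energy_form \<Omega> \<V> v v"
      using lower[OF v] \<open>c > 0\<close> \<open>C > 0\<close> by (intro mult_left_mono) auto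
    finally have "L2_inner \<Omega> w w * L2_inner \<Omega> v v \<le> L2_inner \<Omega> w w * (C / c * energy_form \<Omega> \<V> v v)"
      by (intro mult_left_mono L2_inner_self_nonneg)
    then show "(L2_inner \<Omega> w v)\<^sup>2 \<le> L2_inner \<Omega> w w * (C / c) * energy_form \<Omega> \<V> v v"
      using L2_Cauchy_Schwarz[OF w H10_L2[OF v]] by (simp add: mult.assoc)
  qed (auto simp: L2_inner_add_right L2_inner_cmult_right H10_L2 w)
  then show ?thesis
    unfolding solution_op_def by (intro someI2_ex[of _ "\<lambda>u. u \<in> H10 \<Omega>"]) blast+
qed

subsection \<open>The linear system of one time step\<close>

lemma L2_sum: "finite I \<Longrightarrow> (\<And>i. i \<in> I \<Longrightarrow> u i \<in> L2 \<Omega>) \<Longrightarrow> (\<lambda>x. \<Sum>i\<in>I. u i x) \<in> L2 \<Omega>"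
  by (induction I rule: finite_induct) (auto intro: L2_add)

lemma L2_inner_sum_right:
  assumes "finite I" "\<And>i. i \<in> I \<Longrightarrow> u i \<in> L2 \<Omega>" "w \<in> L2 \<Omega>"
  shows "L2_inner \<Omega> w (\<lambda>x. \<Sum>i\<in>I. u i x) = (\<Sum>i\<in>I. L2_inner \<Omega> w (u i))"
  using assms
proof (induction I rule: finite_induct)
  case empty
  then show ?case by (simp add: L2_inner_def)
next
  case (insert i I)
  then have "L2_inner \<Omega> w (\<lambda>x. u i x + (\<Sum>i\<in>I. u i x)) = L2_inner \<Omega> w (u i) + L2_inner \<Omega> w (\<lambda>x. \<Sum>i\<in>I. u i x)"
    by (intro L2_inner_add_right L2_sum) auto
  with insert show ?case by simp
qed

text \<open>Leaving the coefficients free lets them become the unknowns of a linear system;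
  \<open>skew_op\<close> inserts inner products for them. The minus sign sits on the coefficient so
  that the rules for sums and multiples apply.\<close>

definition skew_comb ::
    "('n::finite \<Rightarrow> 'd::finite scalar_field) \<Rightarrow> ('n \<Rightarrow> 'd scalar_field) \<Rightarrow> ('n \<Rightarrow> real) \<Rightarrow> ('n \<Rightarrow> real) \<Rightarrow> 'd scalar_field" where
  "skew_comb a b p r = (\<lambda>x. \<Sum>i\<in>UNIV. r i * a i x + - p i * b i x)"

text \<open>
  The action of \<open>\<L>\<^sub>U\<close> on one component of a tuple, with \<open>a = U\<close> and \<open>b = \<G>U\<close>.
\<close>

definition skew_op ::
    "(real ^ 'd::finite) set \<Rightarrow> ('n::finite \<Rightarrow> 'd scalar_field) \<Rightarrow> ('n \<Rightarrow> 'd scalar_field) \<Rightarrow> 'd scalar_field \<Rightarrow> 'd scalar_field" where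
  "skew_op \<Omega> a b v = skew_comb a b (\<lambda>i. L2_inner \<Omega> (a i) v) (\<lambda>i. L2_inner \<Omega> (b i) v)"

text \<open>Column \<open>k\<close> of either Gram matrix involves only the component
  \<open>V k\<close>, which decouples the components.\<close>

lemma L_op_eq_skew_op: "L_op \<Omega> \<V> U V k = skew_op \<Omega> U (tuple_solution_op \<Omega> \<V> U) (V k)"
  by (simp add: fun_eq_iff L_op_def tuple_mult_def gram_def skew_op_def skew_comb_def
      sum_subtractf mult.commute)

context
  fixes \<Omega> :: "(real ^ 'd::finite) set" and a b :: "'n::finite \<Rightarrow> 'd scalar_field"
  assumes a: "\<And>i. a i \<in> L2 \<Omega>" and b: "\<And>i. b i \<in> L2 \<Omega>"
begin

lemma skew_comb_L2: "skew_comb a b p r \<in> L2 \<Omega>"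
  unfolding skew_comb_def by (intro L2_sum L2_add L2_cmult a b) auto

lemma L2_inner_skew_comb:
  assumes "w \<in> L2 \<Omega>"
  shows "L2_inner \<Omega> w (skew_comb a b p r)
    = (\<Sum>i\<in>UNIV. r i * L2_inner \<Omega> w (a i) + - p i * L2_inner \<Omega> w (b i))"
proof -
  have "L2_inner \<Omega> w (skew_comb a b p r)
      = (\<Sum>i\<in>UNIV. L2_inner \<Omega> w (\<lambda>x. r i * a i x + - p i * b i x))"
    unfolding skew_comb_def by (intro L2_inner_sum_right L2_add L2_cmult a b assms) auto
  also have "\<dots> = (\<Sum>i\<in>UNIV. r i * L2_inner \<Omega> w (a i) + - p i * L2_inner \<Omega> w (b i))"
    by (subst L2_inner_add_right[OF L2_cmult[OF a] L2_cmult[OF b] assms])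
      (simp only: L2_inner_cmult_right)
  finally show ?thesis .
qed

lemma skew_op_L2: "skew_op \<Omega> a b v \<in> L2 \<Omega>"
  unfolding skew_op_def by (rule skew_comb_L2)

lemma skew_op_diff:
  assumes "v \<in> L2 \<Omega>" "w \<in> L2 \<Omega>"
  shows "skew_op \<Omega> a b (\<lambda>x. v x - w x) = (\<lambda>x. skew_op \<Omega> a b v x - skew_op \<Omega> a b w x)"
proof -
  have diff: "L2_inner \<Omega> u (\<lambda>x. v x - w x) = L2_inner \<Omega> u v - L2_inner \<Omega> u w" if "u \<in> L2 \<Omega>" for u
    using L2_inner_diff_left[OF assms that] by (simp add: L2_inner_commute)
  show ?thesis
    unfolding skew_op_def skew_comb_def diff[OF a] diff[OF b]
    by (simp add: fun_eq_iff algebra_simps flip: sum_subtractf)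
qed

text \<open>Both sides are sums of products of two inner products; exchanging \<open>v\<close> and
  \<open>w\<close> exchanges the positive with the negative terms.\<close>

lemma skew_op_skew:
  assumes "v \<in> L2 \<Omega>" "w \<in> L2 \<Omega>"
  shows "L2_inner \<Omega> v (skew_op \<Omega> a b w) = - L2_inner \<Omega> w (skew_op \<Omega> a b v)"
  unfolding skew_op_def L2_inner_skew_comb[OF assms(1)] L2_inner_skew_comb[OF assms(2)]
  by (simp add: L2_inner_commute[of \<Omega> v] L2_inner_commute[of \<Omega> w] sum_negf[symmetric] mult.commute
      del: sum_negf)

text \<open>Pairing the equation with \<open>v\<close> itself annihilates the right-hand side,
  whatever the sign and size of \<open>s\<close>. This gives both the injectivity behind existence
  and the uniqueness of the step.\<close>

lemma skew_op_fixed_point_eq_0: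
  assumes v: "v \<in> L2 \<Omega>" and eq: "ae_eq \<Omega> v (\<lambda>x. s * skew_op \<Omega> a b v x)"
  shows "ae_eq \<Omega> v (\<lambda>_. 0)"
proof (rule L2_inner_self_eq_0_imp[OF v])
  have "L2_inner \<Omega> v v = L2_inner \<Omega> v (\<lambda>x. s * skew_op \<Omega> a b v x)"
    by (rule L2_inner_ae_cong) (use v eq skew_op_L2 in \<open>auto simp: ae_eq_def intro: L2_cmult\<close>)
  then show "L2_inner \<Omega> v v = 0"
    using skew_op_skew[OF v v] by (simp add: L2_inner_cmult_right)
qed

text \<open>
  The solution is \<open>u\<close> plus a combination of the \<open>a i\<close> and \<open>b i\<close>, so that only the finitely many
  coefficients have to be found: an injective endomorphism of a finite-dimensional space is onto.
\<close>

lemma skew_op_resolvent: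
  assumes u: "u \<in> L2 \<Omega>"
  obtains p r where "skew_op \<Omega> a b (\<lambda>x. u x - s * skew_comb a b p r x) = skew_comb a b p r"
proof -
  define V where "V z = skew_comb a b (($) (fst z)) (($) (snd z))" for z :: "(real ^ 'n) \<times> (real ^ 'n)"
  have V_L2: "V z \<in> L2 \<Omega>" for z unfolding V_def by (rule skew_comb_L2)
  \<comment> \<open>The coefficients of \<open>V z\<close> have to equal the inner products of the
    \<open>a j\<close> and \<open>b j\<close> with \<open>u - s * V z\<close>. \<open>F\<close>
    collects the terms in \<open>z\<close>; those in \<open>u\<close> form the right-hand
    side.\<close>
  define F where "F z = ((\<chi> j. fst z $ j + s * L2_inner \<Omega> (a j) (V z)),
      (\<chi> j. snd z $ j + s * L2_inner \<Omega> (b j) (V z)))" for z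
  have "linear F"
    by (intro linearI)
      (simp_all add: F_def V_def L2_inner_skew_comb[OF a] L2_inner_skew_comb[OF b] vec_eq_iff
        algebra_simps sum.distrib sum_distrib_left sum_subtractf sum_negf)
  moreover have "inj F"
    unfolding linear_injective_0[OF \<open>linear F\<close>]
  proof (intro allI impI)
    fix z assume z: "F z = 0"
    \<comment> \<open>For \<open>z\<close> in the kernel the coefficients of \<open>V z\<close> are
      the inner products with this \<open>v\<close>, so \<open>V z\<close> is
      \<open>skew_op \<Omega> a b v\<close> and \<open>v\<close> solves the homogeneous
      equation.\<close>
    define v where "v x = - s * V z x" for x
    have v_L2: "v \<in> L2 \<Omega>" unfolding v_def by (intro L2_cmult V_L2)
    have "fst z $ j + s * L2_inner \<Omega> (a j) (V z) = 0" "snd z $ j + s * L2_inner \<Omega> (b j) (V z) = 0" for j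
      using z by (simp_all add: F_def zero_prod_def vec_eq_iff)
    moreover have "L2_inner \<Omega> w v = - s * L2_inner \<Omega> w (V z)" for w
      unfolding v_def by (rule L2_inner_cmult_right)
    ultimately have pr: "fst z $ j = L2_inner \<Omega> (a j) v" "snd z $ j = L2_inner \<Omega> (b j) v" for j
      by (simp_all flip: eq_neg_iff_add_eq_0)
    have "skew_op \<Omega> a b v = V z"
      unfolding skew_op_def V_def by (simp add: pr[symmetric])
    then have "ae_eq \<Omega> v (\<lambda>x. - s * skew_op \<Omega> a b v x)"
      by (simp add: ae_eq_def v_def)
    then have v0: "ae_eq \<Omega> v (\<lambda>_. 0)" by (rule skew_op_fixed_point_eq_0[OF v_L2])
    have "L2_inner \<Omega> w v = 0" if "w \<in> L2 \<Omega>" for w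
    proof -
      have "L2_inner \<Omega> w v = L2_inner \<Omega> w (\<lambda>_. 0)"
        by (rule L2_inner_ae_cong) (use that v_L2 v0 in \<open>auto simp: ae_eq_def\<close>)
      then show ?thesis by (simp add: L2_inner_def)
    qed
    \<comment> \<open>By \<open>pr\<close> the coefficients themselves are inner products with
      \<open>v\<close>, so they vanish even if the \<open>a i\<close> and \<open>b i\<close> are
      linearly dependent.\<close>
    then show "z = 0" using pr a b by (simp add: prod_eq_iff vec_eq_iff)
  qed
  ultimately have "surj F" by (simp add: linear_injective_imp_surjective)
  then obtain z where z: "F z = ((\<chi> j. L2_inner \<Omega> (a j) u), (\<chi> j. L2_inner \<Omega> (b j) u))"
    by (metis surjD)
  have "L2_inner \<Omega> w (\<lambda>x. u x - s * V z x) = L2_inner \<Omega> w u - s * L2_inner \<Omega> w (V z)" if "w \<in> L2 \<Omega>" for w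
    using L2_inner_diff_left[OF u L2_cmult[OF V_L2] that, of s z]
    by (simp add: L2_inner_commute[of \<Omega> w] L2_inner_cmult_left)
  moreover have "fst z $ j + s * L2_inner \<Omega> (a j) (V z) = L2_inner \<Omega> (a j) u"
    "snd z $ j + s * L2_inner \<Omega> (b j) (V z) = L2_inner \<Omega> (b j) u" for j
    using z by (simp_all add: F_def vec_eq_iff)
  ultimately have "L2_inner \<Omega> (a j) (\<lambda>x. u x - s * V z x) = fst z $ j"
    "L2_inner \<Omega> (b j) (\<lambda>x. u x - s * V z x) = snd z $ j" for j
    using a b by (simp_all add: eq_diff_eq[symmetric])
  then have "skew_op \<Omega> a b (\<lambda>x. u x - s * V z x) = V z"
    unfolding skew_op_def V_def by simp
  then show thesis unfolding V_def by (rule that)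
qed

end

text \<open>Rescaled to the half-increment, the counterpart of the midpoint: \<open>U'\<close> and
  \<open>U\<close> are the sum and the difference of midpoint and half-increment.\<close>

lemma scheme_step_iff:
  assumes "\<tau> > 0"
  shows "scheme_step \<Omega> \<V> \<tau> U U' \<longleftrightarrow>
    (\<forall>k. ae_eq \<Omega> (\<lambda>x. (U' k x - U k x) / 2)
      (\<lambda>x. - (\<tau> / 2) * skew_op \<Omega> U (tuple_solution_op \<Omega> \<V> U) (\<lambda>x. (U' k x + U k x) / 2) x))"
proof -
  have eq: "(p - q) / \<tau> = - t \<longleftrightarrow> (p - q) / 2 = - (\<tau> / 2) * t" for p q t :: real
    using assms by (simp add: field_simps)
  show ?thesis
    by (simp only: scheme_step_def tuple_ae_eq_def ae_eq_def L_op_eq_skew_op eq)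
qed

theorem theorem4p1:
  fixes \<Omega> :: "(real ^ 'd::finite) set"
    and \<V> :: "real ^ 'd \<Rightarrow> real"
    and c\<^sub>1 c\<^sub>2 \<tau> :: real
    and U :: "'n::finite \<Rightarrow> real ^ 'd \<Rightarrow> real"
  assumes "bounded_domain \<Omega>"
    and "energy_form_defined \<Omega> \<V>"
    and "inner_product_on_H10 \<Omega> (energy_form \<Omega> \<V>)"
    and "c\<^sub>1 > 0" and "c\<^sub>2 > 0"
    and "\<And>u. u \<in> H10 \<Omega> \<Longrightarrow> c\<^sub>1 * (grad_norm \<Omega> u)\<^sup>2 \<le> energy_form \<Omega> \<V> u u"
    and "\<And>u. u \<in> H10 \<Omega> \<Longrightarrow> energy_form \<Omega> \<V> u u \<le> c\<^sub>2 * (grad_norm \<Omega> u)\<^sup>2"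
    and "U \<in> H10_tuples \<Omega>"
    and "gram \<Omega> U U = mat 1"
    and "\<tau> > 0"
  shows "(\<exists>U' \<in> H10_tuples \<Omega>. scheme_step \<Omega> \<V> \<tau> U U' \<and>
            (\<forall>W \<in> H10_tuples \<Omega>. scheme_step \<Omega> \<V> \<tau> U W \<longrightarrow> tuple_ae_eq \<Omega> W U')) \<and>
         (\<forall>U' \<in> H10_tuples \<Omega>. scheme_step \<Omega> \<V> \<tau> U U' \<longrightarrow>
            gram \<Omega> U' U' = gram \<Omega> U U \<and> gram \<Omega> U U = mat 1)"
proof -
  note domain = assms(1)
  define G where "G = tuple_solution_op \<Omega> \<V> U"
  define s where "s = \<tau> / 2"
  let ?L = "skew_op \<Omega> U G"
  have U_H10: "U i \<in> H10 \<Omega>" for i using assms(8) by (simp add: H10_tuples_def)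
  have G_H10: "G i \<in> H10 \<Omega>" for i
    unfolding G_def tuple_solution_op_def
    by (rule solution_op_H10[OF domain assms(3,4,6,7)]) (auto intro: H10_L2 U_H10)
  note U_L2 = H10_L2[OF U_H10] and G_L2 = H10_L2[OF G_H10]
  have step_iff: "scheme_step \<Omega> \<V> \<tau> U U' \<longleftrightarrow>
      (\<forall>k. ae_eq \<Omega> (\<lambda>x. (U' k x - U k x) / 2) (\<lambda>x. - s * ?L (\<lambda>x. (U' k x + U k x) / 2) x))" for U'
    unfolding s_def G_def by (rule scheme_step_iff[OF assms(10)])
  have mean_L2: "(\<lambda>x. (v x + w x) / 2) \<in> L2 \<Omega>" "(\<lambda>x. (v x - w x) / 2) \<in> L2 \<Omega>"
    if "v \<in> L2 \<Omega>" "w \<in> L2 \<Omega>" for v w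
    using L2_cmult[OF L2_add[OF that], of "1/2"] L2_cmult[OF L2_diff[OF that], of "1/2"] by simp_all

  have "\<forall>k. \<exists>p r. ?L (\<lambda>x. U k x - s * skew_comb U G p r x) = skew_comb U G p r"
    by (intro allI, rule skew_op_resolvent[OF U_L2 G_L2 U_L2]) (intro exI)
  then have "\<exists>p r. \<forall>k. ?L (\<lambda>x. U k x - s * skew_comb U G (p k) (r k) x) = skew_comb U G (p k) (r k)"
    by (simp only: choice_iff)
  then obtain p r where
    "\<forall>k. ?L (\<lambda>x. U k x - s * skew_comb U G (p k) (r k) x) = skew_comb U G (p k) (r k)"
    by (elim exE)
  note pr = this[rule_format]
  \<comment> \<open>Twice the midpoint given by the resolvent, minus \<open>U\<close>; hence the
    factor \<open>2 * s\<close>.\<close>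
  define U1 where "U1 k x = U k x - 2 * s * skew_comb U G (p k) (r k) x" for k x
  \<comment> \<open>The resolvent is solved in \<open>L2\<close> only; that the new iterate stays in
    \<open>H10 \<Omega>\<close> is due to \<open>U\<close> and \<open>G\<close> lying there.\<close>
  have "skew_comb U G p r \<in> H10 \<Omega>" for p r
    unfolding skew_comb_def
    by (intro H10_sum[OF domain] H10_add[OF domain] H10_cmult[OF domain] U_H10 G_H10) simp
  then have U1_H10: "U1 \<in> H10_tuples \<Omega>"
    unfolding H10_tuples_def U1_def by (auto intro!: H10_diff[OF domain] H10_cmult[OF domain] U_H10)
  have mean: "(\<lambda>x. (U1 k x + U k x) / 2) = (\<lambda>x. U k x - s * skew_comb U G (p k) (r k) x)" for k
    by (auto simp: U1_def)
  have step: "scheme_step \<Omega> \<V> \<tau> U U1"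
    unfolding step_iff mean pr by (auto simp: ae_eq_def U1_def)

  have unique: "tuple_ae_eq \<Omega> W U1" if W: "W \<in> H10_tuples \<Omega>" "scheme_step \<Omega> \<V> \<tau> U W" for W
    unfolding tuple_ae_eq_def
  proof
    fix k
    have L2s: "W k \<in> L2 \<Omega>" "U1 k \<in> L2 \<Omega>" using W U1_H10 by (auto intro: H10_tuples_L2)
    define d where "d x = (W k x - U1 k x) / 2" for x
    have d_L2: "d \<in> L2 \<Omega>" unfolding d_def by (rule mean_L2[OF L2s])
    have "?L (\<lambda>x. (W k x + U k x) / 2 - (U1 k x + U k x) / 2)
        = (\<lambda>x. ?L (\<lambda>x. (W k x + U k x) / 2) x - ?L (\<lambda>x. (U1 k x + U k x) / 2) x)"
      by (intro skew_op_diff U_L2 G_L2 mean_L2 L2s)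
    moreover have "(\<lambda>x. (W k x + U k x) / 2 - (U1 k x + U k x) / 2) = d"
      by (auto simp: d_def field_simps)
    ultimately have L_d: "?L d x = ?L (\<lambda>x. (W k x + U k x) / 2) x - ?L (\<lambda>x. (U1 k x + U k x) / 2) x" for x
      by simp
    \<comment> \<open>Both the midpoints and the half-increments of the two solutions differ by
      \<open>d\<close>, since \<open>U\<close> cancels.\<close>
    have "ae_eq \<Omega> d (\<lambda>x. - s * ?L d x)"
      unfolding ae_eq_def
      using W(2)[unfolded step_iff, rule_format, of k, unfolded ae_eq_def]
        step[unfolded step_iff, rule_format, of k, unfolded ae_eq_def]
    proof eventually_elim
      case (elim x)
      then show ?case unfolding L_d d_def right_diff_distrib by argo
    qed
    from skew_op_fixed_point_eq_0[OF U_L2 G_L2 d_L2 this]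
    show "ae_eq \<Omega> (W k) (U1 k)" by (simp add: ae_eq_def d_def)
  qed

  have conserve: "gram \<Omega> U' U' = gram \<Omega> U U" if U': "U' \<in> H10_tuples \<Omega>" "scheme_step \<Omega> \<V> \<tau> U U'" for U'
  proof -
    define V where "V k x = (U' k x + U k x) / 2" for k x
    define D where "D k x = (U' k x - U k x) / 2" for k x
    have V_L2: "V k \<in> L2 \<Omega>" and D_L2: "D k \<in> L2 \<Omega>" for k
      unfolding V_def D_def using H10_tuples_L2[OF U'(1)] U_L2 by (auto intro: mean_L2)
    have VD: "L2_inner \<Omega> (V j) (D k) = - s * L2_inner \<Omega> (V j) (?L (V k))" for j k
    proof -
      have "ae_eq \<Omega> (D k) (\<lambda>x. - s * ?L (V k) x)"
        using U'(2) unfolding step_iff V_def D_def by blast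
      then have "L2_inner \<Omega> (V j) (D k) = L2_inner \<Omega> (V j) (\<lambda>x. - s * ?L (V k) x)"
        by (intro L2_inner_ae_cong V_L2 D_L2 L2_cmult skew_op_L2 U_L2 G_L2) (simp_all add: ae_eq_def)
      then show ?thesis by (simp only: L2_inner_cmult_right)
    qed
    have "L2_inner \<Omega> (U' j) (U' k) = L2_inner \<Omega> (U j) (U k)" for j k
    proof -
      have U'_eq: "U' i = (\<lambda>x. V i x + D i x)" and U_eq: "U i = (\<lambda>x. V i x + (-1) * D i x)" for i
        by (auto simp: V_def D_def field_simps)
      \<comment> \<open>With \<open>U' = V + D\<close> and \<open>U = V - D\<close> the pure terms
        cancel and the mixed ones double. Two different indices are needed for the off-diagonal
        entries of the Gram matrix.\<close>
      have "L2_inner \<Omega> (U' j) (U' k) - L2_inner \<Omega> (U j) (U k)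
          = 2 * (L2_inner \<Omega> (V j) (D k) + L2_inner \<Omega> (V k) (D j))"
        unfolding U'_eq U_eq
        by (simp only: L2_inner_add_left L2_inner_add_right L2_add L2_cmult V_L2 D_L2
            L2_inner_cmult_left L2_inner_cmult_right L2_inner_commute[of \<Omega> "D j" "V k"]) algebra
      also have "\<dots> = 0"
        unfolding VD using skew_op_skew[of U \<Omega> G, OF U_L2 G_L2 V_L2[of k] V_L2[of j]] by simp
      finally show ?thesis by simp
    qed
    then show ?thesis by (simp add: gram_def)
  qed
  show ?thesis using U1_H10 step unique conserve assms(9) by blast
qed

end
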